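(* Let $G=(V,E,w)$ be a finite vertex-weighted graph with nonnegative rational vertex weights and maximum degree $\Delta$, and let $(C'_1,\dots,C'_\kappa)$ be any $\kappa$-coloring of $G$. For any $\varepsilon\in(0,0.1]$ and integer $k\in\mathbb{Z}_+$, if $k\ge\max\left\{\frac{\kappa}{\varepsilon},2\Delta\right\}$ and $\max_{v\in V}w_v\le\varepsilon\frac{w(V)}{k}$, then there exists a $(1+7\varepsilon)$-EQ1 $k$-coloring of $G$. Furthermore, given the $\kappa$-coloring $(C'_1,\dots,C'_\kappa)$, such a $k$-coloring can be computed in time polynomial in $|V|$ and $\frac{1}{\varepsilon}$.
   Context: For $S\subseteq V$, $w(S)=\sum_{v\in S}w_v$. A $k$-coloring of $G$ is a partition $(C_1,\dots,C_k)$ of $V$ into $k$ (possibly empty) sets, each of which is an independent set of $G$. For $\alpha\ge 1$, a coloring $(C_1,\dots,C_k)$ is $\alpha$-EQ1 if for every $i,j\in[k]$ with $C_i\neq\emptyset$ there exists a vertex $\bar v\in C_i$ such that $w(C_i\setminus\{\bar v\})\le \alpha\, w(C_j)$. *)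

theory Defs
  imports Complex_Main "HOL-Library.Disjoint_Sets"
begin

definition simple_graph :: "'v set \<Rightarrow> 'v set set \<Rightarrow> bool" where
  "simple_graph V E \<longleftrightarrow> finite V \<and> (\<forall>e\<in>E. e \<subseteq> V \<and> card e = 2)"

definition degree :: "'v set set \<Rightarrow> 'v \<Rightarrow> nat" where
  "degree E v = card {u. {u, v} \<in> E}"

text \<open>\<^term>\<open>Sup {} = (0::nat)\<close>, so the graph without vertices has maximum degree 0.\<close>

definition max_degree :: "'v set \<Rightarrow> 'v set set \<Rightarrow> nat" where
  "max_degree V E = (SUP v\<in>V. degree E v)"

definition independent_set :: "'v set set \<Rightarrow> 'v set \<Rightarrow> bool" where
  "independent_set E S \<longleftrightarrow> (\<forall>u\<in>S. \<forall>v\<in>S. {u, v} \<notin> E)"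

definition weight :: "('v \<Rightarrow> rat) \<Rightarrow> 'v set \<Rightarrow> rat" where
  "weight w S = (\<Sum>v\<in>S. w v)"

text \<open>A tuple $(C_1,\dots,C_k)$ is a function of which only the values on \<open>{1..k}\<close> matter.\<close>

definition is_coloring :: "'v set \<Rightarrow> 'v set set \<Rightarrow> nat \<Rightarrow> (nat \<Rightarrow> 'v set) \<Rightarrow> bool" where
  "is_coloring V E k C \<longleftrightarrow>
     (\<Union>i\<in>{1..k}. C i) = V \<and> disjoint_family_on C {1..k} \<and>
     (\<forall>i\<in>{1..k}. independent_set E (C i))"

definition is_EQ1 :: "('v \<Rightarrow> rat) \<Rightarrow> real \<Rightarrow> nat \<Rightarrow> (nat \<Rightarrow> 'v set) \<Rightarrow> bool" where
  "is_EQ1 w \<alpha> k C \<longleftrightarrow>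
     (\<forall>i\<in>{1..k}. \<forall>j\<in>{1..k}. C i \<noteq> {} \<longrightarrow>
        (\<exists>v\<in>C i. real_of_rat (weight w (C i - {v})) \<le> \<alpha> * real_of_rat (weight w (C j))))"

text \<open>The bound on the maximum weight is stated pointwise so that it also makes sense
  for \<open>V = {}\<close>.\<close>

definition eq1_hypotheses ::
  "'v set \<Rightarrow> 'v set set \<Rightarrow> ('v \<Rightarrow> rat) \<Rightarrow> nat \<Rightarrow> (nat \<Rightarrow> 'v set) \<Rightarrow> real \<Rightarrow> nat \<Rightarrow> bool" where
  "eq1_hypotheses V E w \<kappa> C' \<epsilon> k \<longleftrightarrow>
     simple_graph V E \<and> (\<forall>v\<in>V. 0 \<le> w v) \<and> is_coloring V E \<kappa> C' \<and>
     0 < \<epsilon> \<and> \<epsilon> \<le> 1 / 10 \<and> 0 < k \<and>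
     real k \<ge> max (real \<kappa> / \<epsilon>) (2 * real (max_degree V E)) \<and>
     (\<forall>v\<in>V. real_of_rat (w v) \<le> \<epsilon> * (real_of_rat (weight w V) / real k))"

text \<open>
  The model of computation is a random access machine programmed by while programs. Its memory
  consists of unbounded arrays of natural numbers and unbounded arrays of real numbers; a
  scalar variable is the entry 0 of an array. Every assignment and every evaluated test costs one
  step, which up to a constant factor depending on the program is the number of elementary
  operations.

  Addition, (truncated) subtraction and comparison are the only operations on numbers: there is
  neither multiplication nor rounding. Hence, if all inputs are rational, after \<open>t\<close> steps every
  number in memory is a multiple of the inverse of the common denominator of the inputs and
  its absolute value is at most the largest input or program constant times $2^{O(t)}$. Counting
  arithmetic operations at unit cost is thus polynomially equivalent to counting bit operations,
  while the number of steps is meaningful without reference to the encoding length of the weights.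
  Real cells are used since \<open>\<epsilon>\<close>, which is part of the input, need not be rational.
\<close>

type_synonym aname = string
type_synonym state = "(aname \<Rightarrow> nat \<Rightarrow> nat) \<times> (aname \<Rightarrow> nat \<Rightarrow> real)"

datatype nexp = NConst nat | NCell aname nexp | NPlus nexp nexp | NMinus nexp nexp

datatype rexp = RConst nat | RCell aname nexp | RPlus rexp rexp | RMinus rexp rexp

datatype bexp = NLess nexp nexp | RLess rexp rexp | BNot bexp | BAnd bexp bexp

datatype com =
    Skip
  | NAssign aname nexp nexp
  | RAssign aname nexp rexp
  | Seq com com
  | Cond bexp com com
  | While bexp com

fun nval :: "nexp \<Rightarrow> state \<Rightarrow> nat" where
  "nval (NConst c) s = c"
| "nval (NCell x a) s = fst s x (nval a s)"
| "nval (NPlus a b) s = nval a s + nval b s"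
| "nval (NMinus a b) s = nval a s - nval b s"

fun rval :: "rexp \<Rightarrow> state \<Rightarrow> real" where
  "rval (RConst c) s = real c"
| "rval (RCell x a) s = snd s x (nval a s)"
| "rval (RPlus a b) s = rval a s + rval b s"
| "rval (RMinus a b) s = rval a s - rval b s"

fun bval :: "bexp \<Rightarrow> state \<Rightarrow> bool" where
  "bval (NLess a b) s \<longleftrightarrow> nval a s < nval b s"
| "bval (RLess a b) s \<longleftrightarrow> rval a s < rval b s"
| "bval (BNot b) s \<longleftrightarrow> \<not> bval b s"
| "bval (BAnd b c) s \<longleftrightarrow> bval b s \<and> bval c s"

definition upd :: "(aname \<Rightarrow> nat \<Rightarrow> 'a) \<Rightarrow> aname \<Rightarrow> nat \<Rightarrow> 'a \<Rightarrow> (aname \<Rightarrow> nat \<Rightarrow> 'a)" where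
  "upd m x a y = m(x := (m x)(a := y))"

text \<open>\<open>runs c s t s'\<close>: started in state \<open>s\<close>, the program \<open>c\<close> halts after \<open>t\<close> steps in state \<open>s'\<close>.\<close>

inductive runs :: "com \<Rightarrow> state \<Rightarrow> nat \<Rightarrow> state \<Rightarrow> bool" where
  Skip: "runs Skip s 1 s"
| NAssign: "runs (NAssign x a e) s 1 (upd (fst s) x (nval a s) (nval e s), snd s)"
| RAssign: "runs (RAssign x a e) s 1 (fst s, upd (snd s) x (nval a s) (rval e s))"
| Seq: "runs c s t s' \<Longrightarrow> runs d s' t' s'' \<Longrightarrow> runs (Seq c d) s (t + t') s''"
| CondTrue: "bval b s \<Longrightarrow> runs c s t s' \<Longrightarrow> runs (Cond b c d) s (t + 1) s'"
| CondFalse: "\<not> bval b s \<Longrightarrow> runs d s t s' \<Longrightarrow> runs (Cond b c d) s (t + 1) s'"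
| WhileFalse: "\<not> bval b s \<Longrightarrow> runs (While b c) s 1 s"
| WhileTrue: "bval b s \<Longrightarrow> runs c s t s' \<Longrightarrow> runs (While b c) s' t' s'' \<Longrightarrow>
    runs (While b c) s (t + t' + 1) s''"

text \<open>
  Input: a weighted graph with vertices \<open>0, \<dots>, n - 1\<close>, given by its adjacency matrix (stored row
  by row) and its weights, a \<open>\<kappa>\<close>-coloring, given by the color of each vertex, and
  the numbers \<open>k\<close> and \<open>\<epsilon>\<close>. All other cells are 0.
\<close>

definition input_state ::
  "nat \<Rightarrow> nat set set \<Rightarrow> (nat \<Rightarrow> rat) \<Rightarrow> nat \<Rightarrow> (nat \<Rightarrow> nat set) \<Rightarrow> real \<Rightarrow> nat \<Rightarrow> state" where
  "input_state n E w \<kappa> C' \<epsilon> k =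
    (\<lambda>x a. if x = ''n'' \<and> a = 0 then n
           else if x = ''kappa'' \<and> a = 0 then \<kappa>
           else if x = ''k'' \<and> a = 0 then k
           else if x = ''adj'' \<and> a < n * n \<and> {a div n, a mod n} \<in> E then 1
           else if x = ''color'' \<and> a < n then (THE i. i \<in> {1..\<kappa>} \<and> a \<in> C' i)
           else 0,
     \<lambda>x a. if x = ''weight'' \<and> a < n then real_of_rat (w a)
           else if x = ''eps'' \<and> a = 0 then \<epsilon>
           else 0)"

text \<open>Output: the color of each vertex, in the array \<open>out\<close>.\<close>

definition output_coloring :: "nat \<Rightarrow> state \<Rightarrow> nat \<Rightarrow> nat set" where
  "output_coloring n s i = {v. v < n \<and> fst s ''out'' v = i}"

end

theory Submission
  imports Defs
begin

text \<open>
  Let $W = w(V)$, $M = \max_v w_v$ and $T = (W - kM)/(k + \kappa)$. Cut every given color class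
  greedily into pieces, closing a piece as soon as its weight reaches $T$. A piece weighs at most
  $T + M$ and less than $T$ is left over in each class, so fewer than $k$ pieces would have total
  weight less than $k(T + M) + \kappa T = W$: the cutting yields $k$ pieces. They become the colors.
  Each remaining vertex is added to the lightest color not used by its neighbors. At least $k/2$
  colors are free, hence this color weighs at most $2W/k - T$. In the end all colors weigh between
  $T$ and $2W/k - T + M$, and $T \ge \frac{1 - \varepsilon}{1 + \varepsilon} \cdot W/k$ gives the ratio
  $1 + 7\varepsilon$.

  The procedure does not use $\varepsilon$. If $W > 0$, then $\kappa \le k \le n$, so it takes $O(n^2)$
  steps; if $W = 0$, then $k$ is not bounded in terms of $n$, but the given coloring will do.
\<close>

section \<open>Cutting and filling\<close>

text \<open>Greedy placement alone would only give a ratio near 2: with half of the colors blocked,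
  the lightest free color is merely known to weigh at most twice the average. Doubling an average is
  harmless once it is the average of something small. Cutting therefore raises every color to a
  common floor \<open>T\<close> close to the average before any vertex has to avoid its neighbors;
  pieces inside one given class are independent at no cost. From then on only the excesses over
  \<open>T\<close> are averaged. They are nonnegative, and their mean is O(\<epsilon>) times the
  average color weight. The floor is that high because cutting loses at most \<open>M\<close> per
  color to overshooting and \<open>T\<close> per class to leftovers. The assumptions on \<kappa> and
  on the maximum weight say precisely that both losses are at most an \<epsilon>-fraction of the
  total.\<close>

locale piece_cutting =
  fixes n k \<kappa> :: nat and E :: "nat set set" and col :: "nat \<Rightarrow> nat" and w :: "nat \<Rightarrow> real"
    and T M :: real
  assumes w_nonneg: "v < n \<Longrightarrow> 0 \<le> w v"
    and w_le: "v < n \<Longrightarrow> w v \<le> M"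
    and M_nonneg: "0 \<le> M"
    and T_pos: "0 < T"
    and k_pos: "0 < k"
    and col_range: "v < n \<Longrightarrow> col v \<in> {1..\<kappa>}"
    and col_proper: "{u, v} \<in> E \<Longrightarrow> col u \<noteq> col v"
    and edge_vertex: "{u, v} \<in> E \<Longrightarrow> u < n"
    and degree_le: "v < n \<Longrightarrow> 2 * card {u. {u, v} \<in> E} \<le> k"
    and enough: "real (k + \<kappa>) * T + real k * M \<le> sum w {..<n}"
begin

definition load :: "(nat \<Rightarrow> nat) \<Rightarrow> nat \<Rightarrow> real" where
  "load out j = (\<Sum>v | v < n \<and> out v = j. w v)"

definition skipped :: "nat \<Rightarrow> (nat \<Rightarrow> nat) \<Rightarrow> nat \<Rightarrow> real" where
  "skipped i out c = (\<Sum>v | v < i \<and> out v = 0 \<and> col v = c. w v)"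

definition remaining :: "nat \<Rightarrow> nat \<Rightarrow> real" where
  "remaining i c = (\<Sum>v | i \<le> v \<and> v < n \<and> col v = c. w v)"

text \<open>Invariant of the cutting phase after the vertices \<open>0, \<dots>, i - 1\<close>: pieces \<open>1, \<dots>, p\<close> have been
  opened, \<open>cur c\<close> is the open piece of class \<open>c\<close> (0 if there is none), \<open>W j\<close> is the weight of
  piece \<open>j\<close>. A piece is opened only if the rest of its class suffices to complete it, so none is left
  incomplete.\<close>

definition cutting ::
  "nat \<Rightarrow> (nat \<Rightarrow> nat) \<Rightarrow> nat \<Rightarrow> (nat \<Rightarrow> nat) \<Rightarrow> (nat \<Rightarrow> real) \<Rightarrow> (nat \<Rightarrow> real) \<Rightarrow> bool" where
  "cutting i out p cur W R \<longleftrightarrow>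
     i \<le> n \<and> p \<le> k \<and> (\<forall>v. out v \<le> p) \<and> (\<forall>v\<ge>i. out v = 0) \<and>
     (\<forall>u v. out u = out v \<longrightarrow> out u \<noteq> 0 \<longrightarrow> col u = col v) \<and>
     (\<forall>c. cur c \<le> p) \<and>
     (\<forall>c. cur c \<noteq> 0 \<longrightarrow> W (cur c) < T \<and> T \<le> W (cur c) + R c) \<and>
     (\<forall>c v. cur c \<noteq> 0 \<longrightarrow> out v = cur c \<longrightarrow> col v = c) \<and>
     (\<forall>c c'. cur c = cur c' \<longrightarrow> cur c \<noteq> 0 \<longrightarrow> c = c') \<and>
     (\<forall>j. j \<noteq> 0 \<longrightarrow> j \<le> p \<longrightarrow> (\<exists>c. cur c = j) \<or> T \<le> W j) \<and>
     W 0 = 0 \<and> (\<forall>j. j \<noteq> 0 \<longrightarrow> W j = load out j \<and> W j \<le> T + M) \<and>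
     (\<forall>c. R c = remaining i c) \<and>
     (p < k \<longrightarrow> (\<forall>c. skipped i out c = 0 \<or> cur c = 0 \<and> skipped i out c + R c < T))"

text \<open>The last bound: at least half of the colors are free for a vertex, and every color weighs at
  least \<open>T\<close>, so the lightest free color exceeds \<open>T\<close> by at most twice the average excess over \<open>T\<close>.\<close>

definition filling :: "nat \<Rightarrow> (nat \<Rightarrow> nat) \<Rightarrow> (nat \<Rightarrow> real) \<Rightarrow> bool" where
  "filling i out W \<longleftrightarrow>
     (\<forall>v. out v \<le> k) \<and> (\<forall>v<i. out v \<noteq> 0) \<and>
     (\<forall>u v. {u, v} \<in> E \<longrightarrow> out u = out v \<longrightarrow> out u = 0) \<and>
     (\<forall>j\<in>{1..k}. W j = load out j \<and> T \<le> W j \<and>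
        real k * (W j + T) \<le> 2 * sum w {..<n} + real k * M)"

section \<open>Updating the weights of classes and colors\<close>

lemma remaining_Suc:
  assumes "i < n"
  shows "remaining i c = remaining (Suc i) c + (if col i = c then w i else 0)"
proof -
  have "{v. i \<le> v \<and> v < n \<and> col v = c} =
      (if col i = c then insert i else id) {v. Suc i \<le> v \<and> v < n \<and> col v = c}"
    using assms by (auto simp: Suc_le_eq le_less)
  then show ?thesis by (auto simp: remaining_def)
qed

lemma remaining_n: "remaining n c = 0"
  by (auto simp: remaining_def intro!: sum.neutral)

lemma load_upd:
  assumes "i < n" "out i = 0" "j \<noteq> 0"
  shows "load (out(i := b)) j = load out j + (if b = j then w i else 0)"
proof -
  have "{v. v < n \<and> (out(i := b)) v = j} = (if b = j then insert i else id) {v. v < n \<and> out v = j}"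
    using assms by auto
  then show ?thesis using assms by (auto simp: load_def)
qed

lemma skipped_Suc:
  "skipped (Suc i) out c = skipped i out c + (if out i = 0 \<and> col i = c then w i else 0)"
proof -
  have "{v. v < Suc i \<and> out v = 0 \<and> col v = c} =
      (if out i = 0 \<and> col i = c then insert i else id) {v. v < i \<and> out v = 0 \<and> col v = c}"
    by (auto simp: less_Suc_eq)
  then show ?thesis by (auto simp: skipped_def)
qed

lemma skipped_upd: "skipped i (out(i := b)) c = skipped i out c"
  unfolding skipped_def by (intro sum.cong) auto

section \<open>Steps of the cutting phase\<close>

lemma cutting_init: "cutting 0 (\<lambda>_. 0) 0 (\<lambda>_. 0) (\<lambda>_. 0) (remaining 0)"
proof -
  have "load (\<lambda>_. 0) j = 0" if "j \<noteq> 0" for j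
    using that by (simp add: load_def)
  then show ?thesis
    using T_pos M_nonneg by (simp add: cutting_def skipped_def)
qed

lemma cuttingD:
  assumes "cutting i out p cur W R"
  shows cut_i: "i \<le> n" and cut_p: "p \<le> k" and cut_out_le: "out v \<le> p"
    and cut_out_0: "i \<le> v \<Longrightarrow> out v = 0"
    and cut_col: "out u = out v \<Longrightarrow> out u \<noteq> 0 \<Longrightarrow> col u = col v"
    and cut_cur_le: "cur c \<le> p"
    and cut_cur_less: "cur c \<noteq> 0 \<Longrightarrow> W (cur c) < T"
    and cut_cur_ge: "cur c \<noteq> 0 \<Longrightarrow> T \<le> W (cur c) + R c"
    and cut_cur_col: "cur c \<noteq> 0 \<Longrightarrow> out v = cur c \<Longrightarrow> col v = c"
    and cut_cur_inj: "cur c = cur d \<Longrightarrow> cur c \<noteq> 0 \<Longrightarrow> c = d"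
    and cut_closed: "j \<noteq> 0 \<Longrightarrow> j \<le> p \<Longrightarrow> (\<exists>c. cur c = j) \<or> T \<le> W j"
    and cut_W_0: "W 0 = 0"
    and cut_W: "j \<noteq> 0 \<Longrightarrow> W j = load out j"
    and cut_W_le: "j \<noteq> 0 \<Longrightarrow> W j \<le> T + M"
    and cut_R: "R c = remaining i c"
    and cut_skipped: "p < k \<Longrightarrow> skipped i out c = 0 \<or> cur c = 0 \<and> skipped i out c + R c < T"
  using assms unfolding cutting_def by meson+

lemma cuttingI:
  assumes "i \<le> n" "p \<le> k" "\<And>v. out v \<le> p" "\<And>v. i \<le> v \<Longrightarrow> out v = 0"
    and "\<And>u v. out u = out v \<Longrightarrow> out u \<noteq> 0 \<Longrightarrow> col u = col v"
    and "\<And>c. cur c \<le> p"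
    and "\<And>c. cur c \<noteq> 0 \<Longrightarrow> W (cur c) < T"
    and "\<And>c. cur c \<noteq> 0 \<Longrightarrow> T \<le> W (cur c) + R c"
    and "\<And>c v. cur c \<noteq> 0 \<Longrightarrow> out v = cur c \<Longrightarrow> col v = c"
    and "\<And>c d. cur c = cur d \<Longrightarrow> cur c \<noteq> 0 \<Longrightarrow> c = d"
    and "\<And>j. j \<noteq> 0 \<Longrightarrow> j \<le> p \<Longrightarrow> (\<exists>c. cur c = j) \<or> T \<le> W j"
    and "W 0 = 0"
    and "\<And>j. j \<noteq> 0 \<Longrightarrow> W j = load out j"
    and "\<And>j. j \<noteq> 0 \<Longrightarrow> W j \<le> T + M"
    and "\<And>c. R c = remaining i c"
    and "\<And>c. p < k \<Longrightarrow> skipped i out c = 0 \<or> cur c = 0 \<and> skipped i out c + R c < T"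
  shows "cutting i out p cur W R"
  unfolding cutting_def by (intro conjI allI impI) (rule assms; assumption)+

lemma skipped_nonneg: "i \<le> n \<Longrightarrow> 0 \<le> skipped i out c"
  unfolding skipped_def using w_nonneg by (intro sum_nonneg) auto

text \<open>The new color exceeds all values of \<open>out\<close> and \<open>cur\<close>, so its
  piece starts empty, and \<open>T \<le> R c\<close> is exactly the promise that the class can still
  complete it.\<close>

lemma cutting_open:
  assumes cut: "cutting i out p cur W R" and "cur c = 0" "T \<le> R c" "p < k"
  shows "cutting i out (Suc p) (cur(c := Suc p)) W R"
proof -
  have out: "out v \<le> p" and cur: "cur d \<le> p" for v d
    using cut_out_le[OF cut] cut_cur_le[OF cut] by auto
  then have new: "out v \<noteq> Suc p" "cur d \<noteq> Suc p" "cur d \<le> Suc p" "out v \<le> Suc p" for v d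
    by (metis Suc_n_not_le_n, metis Suc_n_not_le_n, metis le_SucI, metis le_SucI)
  then have "load out (Suc p) = 0"
    by (simp add: load_def)
  then have W0: "W (Suc p) = 0" using cut_W[OF cut] by simp
  have closed: "(\<exists>d. (cur(c := Suc p)) d = j) \<or> T \<le> W j" if j: "j \<noteq> 0" "j \<le> Suc p" for j
  proof (cases "j = Suc p")
    case False
    with j have "(\<exists>d. cur d = j) \<or> T \<le> W j" using cut_closed[OF cut, of j] by simp
    with assms(2) j show ?thesis by (metis fun_upd_other)
  qed auto
  \<comment> \<open>Had the class skipped any weight, that weight plus the rest would be below
    \<open>T\<close>, contradicting \<open>T \<le> R c\<close>.\<close>
  have skipped0: "skipped i out c = 0"
    using cut_skipped[OF cut assms(4), of c] skipped_nonneg[OF cut_i[OF cut], of out c] assms(3)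
    by linarith
  have cur_le: "(cur(c := Suc p)) d \<le> Suc p" for d using new(3) by simp
  have R: "W ((cur(c := Suc p)) d) < T" "T \<le> W ((cur(c := Suc p)) d) + R d"
    if "(cur(c := Suc p)) d \<noteq> 0" for d
    using that cut_cur_less[OF cut, of d] cut_cur_ge[OF cut, of d] W0 T_pos assms(3)
    by (cases "d = c"; simp)+
  have inj: "d = e" if "(cur(c := Suc p)) d = (cur(c := Suc p)) e" "(cur(c := Suc p)) d \<noteq> 0" for d e
    using that cut_cur_inj[OF cut, of d e] new(2)[of e] new(2)[of d]
    by (auto split: if_splits)
  have col: "col v = d" if "(cur(c := Suc p)) d \<noteq> 0" "out v = (cur(c := Suc p)) d" for d v
    using that cut_cur_col[OF cut, of d v] new(1)[of v] by (auto split: if_splits)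
  have skip: "skipped i out d = 0 \<or> (cur(c := Suc p)) d = 0 \<and> skipped i out d + R d < T"
    if "Suc p < k" for d
    using cut_skipped[OF cut assms(4), of d] skipped0 by (cases "d = c") auto
  show ?thesis
    by (rule cuttingI)
      (fact cut_i[OF cut] Suc_leI[OF assms(4)] new(4) cut_out_0[OF cut] cut_col[OF cut] cur_le
        R col inj closed cut_W_0[OF cut] cut_W[OF cut] cut_W_le[OF cut] cut_R[OF cut] skip)+
qed

text \<open>Adding the vertex moves \<open>w i\<close> from \<open>R c\<close> to the piece, so
  their sum still suffices to complete it. The piece was below \<open>T\<close> before, hence
  overshoots by at most \<open>M\<close>, and it is closed as soon as it is no longer below
  \<open>T\<close>.\<close>

lemma cutting_add:
  assumes cut: "cutting i out p cur W R" and i: "i < n" "col i = c" and c: "cur c \<noteq> 0"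
  shows "cutting (Suc i) (out(i := cur c)) p
           (if W (cur c) + w i < T then cur else cur(c := 0))
           (W(cur c := W (cur c) + w i)) (R(c := R c - w i))"
proof -
  let ?out = "out(i := cur c)" and ?W = "W(cur c := W (cur c) + w i)"
  let ?cur = "if W (cur c) + w i < T then cur else cur(c := 0)"
  have out0: "out i = 0" using cut_out_0[OF cut] by simp
  have colc: "col v = c" if "out v = cur c" for v
    using cut_cur_col[OF cut c that] .
  have curinj: "d = c" if "cur d = cur c" for d
    using cut_cur_inj[OF cut that] c that by simp
  have Wc: "W (cur c) < T" "T \<le> W (cur c) + R c"
    using cut_cur_less[OF cut c] cut_cur_ge[OF cut c] .
  have cur_le: "?cur d \<le> p" for d using cut_cur_le[OF cut] by simp
  have out_le: "?out v \<le> p" for v using cut_out_le[OF cut] cut_cur_le[OF cut] by simp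
  have out_0: "?out v = 0" if "v \<ge> Suc i" for v
    using cut_out_0[OF cut, of v] that by simp
  have coll: "col u = col v" if "?out u = ?out v" "?out u \<noteq> 0" for u v
    using that cut_col[OF cut, of u v] colc[of u] colc[of v] i by (auto split: if_splits)
  have WR: "?W (?cur d) < T" "T \<le> ?W (?cur d) + (R(c := R c - w i)) d" if "?cur d \<noteq> 0" for d
    using that cut_cur_less[OF cut, of d] cut_cur_ge[OF cut, of d] curinj[of d] Wc
    by (cases "d = c"; auto split: if_splits)+
  have cur_col: "col v = d" if "?cur d \<noteq> 0" "?out v = ?cur d" for d v
  proof -
    have "?cur d = cur d" using that(1) by (simp split: if_splits)
    then have d: "cur d \<noteq> 0" "(out(i := cur c)) v = cur d" using that by argo+
    show ?thesis
    proof (cases "v = i")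
      case True
      with d have "cur d = cur c" by simp
      with i(2) True show ?thesis using curinj by blast
    next
      case False
      with d have "out v = cur d" by simp
      then show ?thesis by (rule cut_cur_col[OF cut d(1)])
    qed
  qed
  have inj: "d = e" if "?cur d = ?cur e" "?cur d \<noteq> 0" for d e
  proof -
    have "?cur e \<noteq> 0" using that by argo
    then have "?cur d = cur d" "?cur e = cur e" using that(2) by (auto split: if_splits)
    then show ?thesis using that cut_cur_inj[OF cut, of d e] by argo
  qed
  have closed: "(\<exists>d. ?cur d = j) \<or> T \<le> ?W j" if j: "j \<noteq> 0" "j \<le> p" for j
  proof (cases "j = cur c")
    case False
    from j have "(\<exists>d. cur d = j) \<or> T \<le> W j" by (rule cut_closed[OF cut])
    then show ?thesis
    proof
      assume "\<exists>d. cur d = j"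
      then obtain d where d: "cur d = j" by blast
      with False have "d \<noteq> c" by blast
      with d have "?cur d = j" by simp
      then show ?thesis by blast
    qed (use False in simp)
  next
    case True
    then have "?cur c = j \<or> T \<le> ?W j" by simp
    then show ?thesis by blast
  qed
  have W_0: "?W 0 = 0" using cut_W_0[OF cut] c by simp
  have W: "?W j = load ?out j" if "j \<noteq> 0" for j
    using cut_W[OF cut that] load_upd[of i out j "cur c", OF i(1) out0 that] by auto
  have W_le: "?W j \<le> T + M" if "j \<noteq> 0" for j
    using cut_W_le[OF cut that] Wc w_le[OF i(1)] by simp
  have R: "(R(c := R c - w i)) d = remaining (Suc i) d" for d
    using cut_R[OF cut, of d] remaining_Suc[OF i(1), of d] i(2) by auto
  have skip: "skipped (Suc i) ?out d = 0 \<or>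
      ?cur d = 0 \<and> skipped (Suc i) ?out d + (R(c := R c - w i)) d < T" if "p < k" for d
  proof -
    have "skipped i out d = 0 \<or> cur d = 0 \<and> skipped i out d + R d < T"
      by (rule cut_skipped[OF cut that])
    moreover have "skipped (Suc i) ?out d = skipped i out d"
      using c by (simp add: skipped_Suc skipped_upd)
    ultimately show ?thesis using c by (auto split: if_splits)
  qed
  show ?thesis
    by (rule cuttingI)
      (fact Suc_leI[OF i(1)] cut_p[OF cut] cur_le out_le out_0 coll WR cur_col inj closed
        W_0 W W_le R skip)+
qed

text \<open>Skipping moves \<open>w i\<close> from \<open>R c\<close> to the skipped weight. While
  \<open>p < k\<close>, their sum thus stays below \<open>T\<close>, which limits what a class
  leaves over; for \<open>p = k\<close> the bound on skipped weight holds vacuously.\<close>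

lemma cutting_skip:
  assumes cut: "cutting i out p cur W R" and i: "i < n" "col i = c" and c: "cur c = 0"
    and full: "R c < T \<or> p = k"
  shows "cutting (Suc i) out p cur W (R(c := R c - w i))"
proof -
  have out0: "out i = 0" using cut_out_0[OF cut] by simp
  have R: "(R(c := R c - w i)) d = remaining (Suc i) d" for d
    using cut_R[OF cut, of d] remaining_Suc[OF i(1), of d] i(2) by auto
  have skip: "skipped (Suc i) out d = 0 \<or>
      cur d = 0 \<and> skipped (Suc i) out d + (R(c := R c - w i)) d < T" if "p < k" for d
  proof -
    have "skipped i out d = 0 \<or> cur d = 0 \<and> skipped i out d + R d < T"
      by (rule cut_skipped[OF cut that])
    then show ?thesis using full c out0 i that by (auto simp: skipped_Suc)
  qed
  have ge: "T \<le> W (cur d) + (R(c := R c - w i)) d" if "cur d \<noteq> 0" for d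
    using cut_cur_ge[OF cut that] c that by auto
  show ?thesis
    by (rule cuttingI)
      (fact Suc_leI[OF i(1)] cut_p[OF cut] cut_out_le[OF cut] cut_out_0[OF cut, OF Suc_leD]
        cut_col[OF cut] cut_cur_le[OF cut] cut_cur_less[OF cut] ge cut_cur_col[OF cut]
        cut_cur_inj[OF cut] cut_closed[OF cut] cut_W_0[OF cut] cut_W[OF cut] cut_W_le[OF cut] R skip)+
qed

section \<open>Weight count at the end of the cutting phase\<close>

lemma sum_load:
  assumes "\<And>v. v < n \<Longrightarrow> out v \<le> k"
  shows "(\<Sum>j\<in>{1..k}. load out j) + (\<Sum>v | v < n \<and> out v = 0. w v) = sum w {..<n}"
proof -
  have "(\<Sum>j\<in>{1..k}. load out j) = (\<Sum>j\<in>{1..k}. \<Sum>v | v \<in> {v. v < n \<and> out v \<noteq> 0} \<and> out v = j. w v)"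
    unfolding load_def by (intro sum.cong) auto
  also have "\<dots> = (\<Sum>v | v < n \<and> out v \<noteq> 0. w v)"
    using assms by (intro sum.group) (auto simp: Suc_le_eq)
  finally have "(\<Sum>j\<in>{1..k}. load out j) + (\<Sum>v | v < n \<and> out v = 0. w v) =
      (\<Sum>v | v < n \<and> out v \<noteq> 0. w v) + (\<Sum>v | v < n \<and> out v = 0. w v)" by simp
  also have "\<dots> = (\<Sum>v\<in>{v. v < n \<and> out v \<noteq> 0} \<union> {v. v < n \<and> out v = 0}. w v)"
    by (intro sum.union_disjoint[symmetric]) auto
  also have "{v. v < n \<and> out v \<noteq> 0} \<union> {v. v < n \<and> out v = 0} = {..<n}" by auto
  finally show ?thesis .
qed

lemma cutting_complete:
  assumes cut: "cutting n out p cur W R"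
  shows "p = k" and "cur c = 0"
proof -
  have R0: "R d = 0" for d using cut_R[OF cut] by (simp add: remaining_n)
  \<comment> \<open>Nothing remains of any class, so an open piece would weigh both less than
    \<open>T\<close> and at least \<open>T\<close>.\<close>
  show cur0: "cur c = 0" for c
    using cut_cur_less[OF cut, of c] cut_cur_ge[OF cut, of c] R0[of c] by force
  show "p = k"
  proof (rule ccontr)
    assume "p \<noteq> k"
    then have p: "p < k" using cut_p[OF cut] by simp
    note out = cut_out_le[OF cut]
    have "skipped n out c \<le> T" for c
      using cut_skipped[OF cut p, of c] T_pos by (auto simp: R0)
    then have "(\<Sum>c\<in>{1..\<kappa>}. skipped n out c) \<le> real \<kappa> * T"
      using sum_bounded_above[of "{1..\<kappa>}" "skipped n out" T] by simp
    moreover have "(\<Sum>c\<in>{1..\<kappa>}. skipped n out c) = (\<Sum>v | v < n \<and> out v = 0. w v)"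
    proof -
      have "(\<Sum>c\<in>{1..\<kappa>}. skipped n out c) =
          (\<Sum>c\<in>{1..\<kappa>}. \<Sum>v | v \<in> {v. v < n \<and> out v = 0} \<and> col v = c. w v)"
        unfolding skipped_def by (intro sum.cong) auto
      also have "\<dots> = (\<Sum>v | v < n \<and> out v = 0. w v)"
        using col_range by (intro sum.group) auto
      finally show ?thesis .
    qed
    moreover have "(\<Sum>j\<in>{1..k}. load out j) \<le> real p * (T + M)"
    proof -
      have "load out j = 0" if "j \<in> {1..k} - {1..p}" for j
        unfolding load_def using out that by (intro sum.neutral) (auto simp: not_le dest: leD)
      then have "(\<Sum>j\<in>{1..k}. load out j) = (\<Sum>j\<in>{1..p}. load out j)"
        using p by (intro sum.mono_neutral_right) auto
      also have "\<dots> \<le> of_nat (card {1..p}) * (T + M)"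
        using cut_W[OF cut] cut_W_le[OF cut] by (intro sum_bounded_above) force
      finally show ?thesis by simp
    qed
    moreover have "real p * (T + M) < real k * (T + M)"
      using p T_pos M_nonneg by (intro mult_strict_right_mono) auto
    moreover have "(\<Sum>j\<in>{1..k}. load out j) + (\<Sum>v | v < n \<and> out v = 0. w v) = sum w {..<n}"
      using out p by (intro sum_load) (meson le_trans less_imp_le)
    ultimately show False
      using enough by (simp add: algebra_simps)
  qed
qed

section \<open>The filling phase\<close>

lemma filling_init:
  assumes cut: "cutting n out p cur W R"
  shows "filling 0 out W"
proof -
  note p = cutting_complete(1)[OF cut] and cur0 = cutting_complete(2)[OF cut]
  have "T \<le> W j \<and> W j = load out j \<and> real k * (W j + T) \<le> 2 * sum w {..<n} + real k * M"
    if j: "j \<in> {1..k}" for j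
  proof -
    have W: "T \<le> W j" "W j = load out j" "W j \<le> T + M"
      using cut_closed[OF cut, of j] cut_W[OF cut, of j] cut_W_le[OF cut, of j] j p cur0 by auto
    \<comment> \<open>For a fresh piece the ceiling reduces to \<open>k * T\<close> being at most
      the total weight, which \<open>enough\<close> gives.\<close>
    have "real k * (W j + T) \<le> real k * (T + M + T)"
      using W by (intro mult_left_mono) auto
    moreover have "0 \<le> real \<kappa> * T" "0 \<le> real k * M" using T_pos M_nonneg by auto
    moreover have "real k * (T + M + T) = 2 * (real k * T) + real k * M"
      "real (k + \<kappa>) * T = real k * T + real \<kappa> * T"
      by (simp_all add: algebra_simps)
    ultimately show ?thesis using enough W by linarith
  qed
  \<comment> \<open>Each piece lies inside one class, whereas an edge joins two classes.\<close>
  moreover have "out u = 0" if "{u, v} \<in> E" "out u = out v" for u v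
    using cut_col[OF cut that(2)] col_proper[OF that(1)] by blast
  ultimately show ?thesis
    unfolding filling_def using cut_out_le[OF cut] p by blast
qed

text \<open>Each neighbor blocks at most one color and there are at most \<open>k/2\<close>
  neighbors. Neighbors still without a color have the value 0, which lies outside
  \<open>{1..k}\<close>.\<close>

lemma card_available:
  assumes "i < n"
  shows "k \<le> 2 * card ({1..k} - out ` {u. {u, i} \<in> E})"
proof -
  have fin: "finite {u. {u, i} \<in> E}"
    by (rule finite_subset[of _ "{..<n}"]) (auto dest: edge_vertex)
  have "card {1..k} - card (out ` {u. {u, i} \<in> E}) \<le> card ({1..k} - out ` {u. {u, i} \<in> E})"
    using fin by (intro diff_card_le_card_Diff) auto
  then show ?thesis
    using card_image_le[OF fin, of out] degree_le[OF assms] by simp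
qed

lemma filling_skip: "filling i out W \<Longrightarrow> out i \<noteq> 0 \<Longrightarrow> filling (Suc i) out W"
  by (auto simp: filling_def less_Suc_eq)

lemma filling_add:
  assumes fill: "filling i out W" and i: "i < n" "out i = 0"
    and b: "b \<in> {1..k} - out ` {u. {u, i} \<in> E}"
    and least: "\<And>j. j \<in> {1..k} - out ` {u. {u, i} \<in> E} \<Longrightarrow> W b \<le> W j"
  shows "filling (Suc i) (out(i := b)) (W(b := W b + w i))"
proof -
  let ?F = "{1..k} - out ` {u. {u, i} \<in> E}"
  have W: "W j = load out j" "T \<le> W j" if "j \<in> {1..k}" for j
    using fill that unfolding filling_def by blast+
  have "real k / 2 * (W b - T) \<le> real (card ?F) * (W b - T)"
    using card_available[OF i(1), of out] W[of b] b by (intro mult_right_mono) auto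
  also have "\<dots> = (\<Sum>j\<in>?F. W b - T)" by simp
  also have "\<dots> \<le> (\<Sum>j\<in>?F. W j - T)" using least by (intro sum_mono) auto
  \<comment> \<open>Here the floor is essential: the excesses of the blocked colors are nonnegative,
    so they may be added.\<close>
  also have "\<dots> \<le> (\<Sum>j\<in>{1..k}. W j - T)" using W by (intro sum_mono2) auto
  also have "\<dots> = (\<Sum>j\<in>{1..k}. load out j) - real k * T"
    using W by (simp add: sum_subtractf)
  also have "\<dots> \<le> sum w {..<n} - real k * T"
  proof -
    have "0 \<le> (\<Sum>v | v < n \<and> out v = 0. w v)" using w_nonneg by (intro sum_nonneg) auto
    then show ?thesis using sum_load[of out] fill by (simp add: filling_def)
  qed
  finally have *: "real k * (W b + T) \<le> 2 * sum w {..<n}" by (simp add: field_simps)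
  have "real k * w i \<le> real k * M" using w_le[OF i(1)] by (intro mult_left_mono) auto
  with * have "real k * (W b + w i + T) \<le> 2 * sum w {..<n} + real k * M"
    by (simp add: algebra_simps)
  moreover have "T \<le> W b + w i" using W[of b] b w_nonneg[OF i(1)] by simp
  moreover have W_le: "real k * (W j + T) \<le> 2 * sum w {..<n} + real k * M" if "j \<in> {1..k}" for j
    using fill that unfolding filling_def by blast
  ultimately have "(W(b := W b + w i)) j = load (out(i := b)) j \<and> T \<le> (W(b := W b + w i)) j \<and>
      real k * ((W(b := W b + w i)) j + T) \<le> 2 * sum w {..<n} + real k * M" if "j \<in> {1..k}" for j
    using load_upd[of i out j b] i W[OF that] W_le[OF that] that by (cases "j = b") auto
  moreover have "(out(i := b)) u = 0" if "{u, v} \<in> E" "(out(i := b)) u = (out(i := b)) v" for u v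
  proof -
    \<comment> \<open>There are no loops, so at most one end of the edge is \<open>i\<close>. The
      other end keeps its color, and \<open>b\<close> avoids it; the flipped edge covers the case
      that \<open>i\<close> is the first end.\<close>
    have "u \<noteq> v" using col_proper that(1) by blast
    moreover have "{v, u} \<in> E" using that(1) by (simp add: insert_commute)
    ultimately show ?thesis
      using that fill b by (auto simp: filling_def split: if_splits)
  qed
  moreover have "(out(i := b)) v \<le> k" "v < Suc i \<Longrightarrow> (out(i := b)) v \<noteq> 0" for v
    using fill b by (auto simp: filling_def less_Suc_eq)
  ultimately show ?thesis unfolding filling_def by blast
qed

end

section \<open>Programs with time bounds\<close>

primrec loop_free :: "com \<Rightarrow> bool" where
  "loop_free Skip = True"
| "loop_free (NAssign x a e) = True"
| "loop_free (RAssign x a e) = True"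
| "loop_free (Seq c d) = (loop_free c \<and> loop_free d)"
| "loop_free (Cond b c d) = (loop_free c \<and> loop_free d)"
| "loop_free (While b c) = False"

text \<open>A functional semantics for straight-line code, so that loop bodies can be evaluated by
  rewriting. The value for \<open>While\<close> is a dummy, guarded by
  \<open>loop_free\<close>.\<close>

primrec exec :: "com \<Rightarrow> state \<Rightarrow> state" where
  "exec Skip s = s"
| "exec (NAssign x a e) s = (upd (fst s) x (nval a s) (nval e s), snd s)"
| "exec (RAssign x a e) s = (fst s, upd (snd s) x (nval a s) (rval e s))"
| "exec (Seq c d) s = exec d (exec c s)"
| "exec (Cond b c d) s = (if bval b s then exec c s else exec d s)"
| "exec (While b c) s = s"

text \<open>Both branches of a conditional are charged, which makes the bound independent of the
  state.\<close>

primrec cost :: "com \<Rightarrow> nat" where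
  "cost Skip = 1"
| "cost (NAssign x a e) = 1"
| "cost (RAssign x a e) = 1"
| "cost (Seq c d) = cost c + cost d"
| "cost (Cond b c d) = cost c + cost d + 1"
| "cost (While b c) = 0"

text \<open>A Hoare triple for total correctness that also bounds the number of steps.\<close>

definition terminates :: "(state \<Rightarrow> bool) \<Rightarrow> com \<Rightarrow> nat \<Rightarrow> (state \<Rightarrow> bool) \<Rightarrow> bool" where
  "terminates P c t Q \<longleftrightarrow> (\<forall>s. P s \<longrightarrow> (\<exists>t' s'. runs c s t' s' \<and> t' \<le> t \<and> Q s'))"

lemma runs_exec: "loop_free c \<Longrightarrow> \<exists>t\<le>cost c. runs c s t (exec c s)"
proof (induction c arbitrary: s)
  case (Seq c d)
  then obtain t t' where "t \<le> cost c" "runs c s t (exec c s)"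
    "t' \<le> cost d" "runs d (exec c s) t' (exec d (exec c s))" by (metis loop_free.simps(4))
  then show ?case using runs.Seq by (fastforce intro!: exI[of _ "t + t'"])
next
  case (Cond b c d)
  then obtain t t' where "t \<le> cost c" "runs c s t (exec c s)"
    "t' \<le> cost d" "runs d s t' (exec d s)" by (metis loop_free.simps(5))
  then show ?case
    using runs.CondTrue[of b s c t "exec c s" d] runs.CondFalse[of b s d t' "exec d s" c]
    by (cases "bval b s") (fastforce intro: exI[of _ "t + 1"] exI[of _ "t' + 1"])+
qed (use runs.intros in \<open>force intro!: exI[of _ 1]\<close>)+

lemma terminates_loop_free:
  assumes "loop_free c" "\<And>s. P s \<Longrightarrow> Q (exec c s)"
  shows "terminates P c (cost c) Q"
  using assms runs_exec unfolding terminates_def by blast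

lemma terminates_Seq:
  "terminates P c t Q \<Longrightarrow> terminates Q d t' S \<Longrightarrow> terminates P (Seq c d) (t + t') S"
  unfolding terminates_def by (meson add_mono runs.Seq)

lemma terminates_Cond:
  assumes "terminates (\<lambda>s. P s \<and> bval b s) c t Q" "terminates (\<lambda>s. P s \<and> \<not> bval b s) d t Q"
  shows "terminates P (Cond b c d) (t + 1) Q"
  using assms unfolding terminates_def by (metis add_le_mono1 runs.CondFalse runs.CondTrue)

lemma terminates_weaken:
  assumes "terminates P c t Q" "\<And>s. P' s \<Longrightarrow> P s" "\<And>s. Q s \<Longrightarrow> Q' s" "t \<le> t'"
  shows "terminates P' c t' Q'"
  using assms unfolding terminates_def by (meson le_trans)

lemma terminates_time: "terminates P c t Q \<Longrightarrow> t \<le> t' \<Longrightarrow> terminates P c t' Q"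
  by (erule terminates_weaken)

text \<open>Pinning the initial state lets the postcondition refer to it, in place of logical
  variables.\<close>

lemma terminates_fix:
  assumes "\<And>s. P s \<Longrightarrow> terminates (\<lambda>s'. s' = s) c t Q"
  shows "terminates P c t Q"
  using assms unfolding terminates_def by blast

section \<open>Counting loops\<close>

definition For :: "aname \<Rightarrow> nexp \<Rightarrow> com \<Rightarrow> com" where
  "For x e c = Seq (NAssign x (NConst 0) (NConst 0))
     (While (NLess (NCell x (NConst 0)) e)
       (Seq c (NAssign x (NConst 0) (NPlus (NCell x (NConst 0)) (NConst 1)))))"

text \<open>The invariant takes the number of finished rounds as a parameter instead of reading it
  from the counter; \<open>index\<close> then lets it survive the assignments to the counter. Each
  round adds one test and one increment to the body; the initialization and the last test account
  for the final 2.\<close>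

lemma terminates_For:
  assumes body: "\<And>m. m < N \<Longrightarrow> terminates (\<lambda>s. I m s \<and> fst s x 0 = m) c t (\<lambda>s. I (Suc m) s \<and> fst s x 0 = m)"
    and index: "\<And>m s y. I m s \<Longrightarrow> I m (upd (fst s) x 0 y, snd s)"
    and bound: "\<And>m s. I m s \<Longrightarrow> nval e s = N"
  shows "terminates (I 0) (For x e c) (N * (t + 2) + 2) (I N)"
proof -
  let ?b = "NLess (NCell x (NConst 0)) e"
  let ?c = "Seq c (NAssign x (NConst 0) (NPlus (NCell x (NConst 0)) (NConst 1)))"
  have loop: "\<exists>t' s'. runs (While ?b ?c) s t' s' \<and> t' \<le> d * (t + 2) + 1 \<and> I N s'"
    if "I m s" "fst s x 0 = m" "m + d = N" for d m s
    using that
  proof (induction d arbitrary: m s)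
    case 0
    then have "\<not> bval ?b s" using bound[OF 0(1)] by simp
    then have "runs (While ?b ?c) s 1 s" by (rule runs.WhileFalse)
    with 0 show ?case by (intro exI[of _ 1] exI[of _ s]) simp
  next
    case (Suc d)
    have "m < N" using Suc.prems(3) by simp
    from body[OF this] obtain t1 s1 where 1: "runs c s t1 s1" "t1 \<le> t" "I (Suc m) s1" "fst s1 x 0 = m"
      using Suc.prems(1,2) unfolding terminates_def by blast
    let ?s = "(upd (fst s1) x 0 (Suc m), snd s1)"
    have "runs ?c s (t1 + 1) ?s"
      using runs.Seq[OF 1(1) runs.NAssign[of x "NConst 0" "NPlus (NCell x (NConst 0)) (NConst 1)" s1]]
        1(4) by simp
    moreover obtain t2 s2 where 2: "runs (While ?b ?c) ?s t2 s2" "t2 \<le> d * (t + 2) + 1" "I N s2"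
      using Suc.IH[of "Suc m" ?s] index[OF 1(3)] Suc.prems(3) by (auto simp: upd_def)
    moreover have "bval ?b s" using Suc.prems bound[OF Suc.prems(1)] by simp
    ultimately have "runs (While ?b ?c) s (t1 + 1 + t2 + 1) s2" by (blast intro: runs.WhileTrue)
    with 1 2 show ?case by (intro exI[of _ "t1 + 1 + t2 + 1"] exI[of _ s2]) auto
  qed
  show ?thesis
    unfolding terminates_def For_def
  proof (intro allI impI)
    fix s assume "I 0 s"
    let ?s = "(upd (fst s) x 0 0, snd s)"
    obtain t' s' where "runs (While ?b ?c) ?s t' s'" "t' \<le> N * (t + 2) + 1" "I N s'"
      using loop[of 0 ?s N] index[OF \<open>I 0 s\<close>] by (auto simp: upd_def)
    moreover have "runs (NAssign x (NConst 0) (NConst 0)) s 1 ?s"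
      using runs.NAssign[of x "NConst 0" "NConst 0" s] by simp
    ultimately show "\<exists>t' s'. runs (Seq (NAssign x (NConst 0) (NConst 0)) (While ?b ?c)) s t' s' \<and>
        t' \<le> N * (t + 2) + 2 \<and> I N s'"
      using runs.Seq by (intro exI[of _ "1 + t'"] exI[of _ s'] conjI) (blast, simp_all)
  qed
qed

section \<open>Frame conditions on memory\<close>

definition agree :: "aname set \<Rightarrow> (aname \<Rightarrow> nat \<Rightarrow> 'a) \<Rightarrow> (aname \<Rightarrow> nat \<Rightarrow> 'a) \<Rightarrow> bool" where
  "agree X f g \<longleftrightarrow> (\<forall>x. x \<notin> X \<longrightarrow> f x = g x)"

lemma agree_upd [simp]: "x \<in> X \<Longrightarrow> agree X f g \<Longrightarrow> agree X (upd f x a y) g"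
  by (simp add: agree_def upd_def)

lemma agree_refl: "agree X f f"
  by (simp add: agree_def)

lemma agree_mono: "agree X f g \<Longrightarrow> X \<subseteq> Y \<Longrightarrow> agree Y f g"
  by (auto simp: agree_def)

lemma agreeD: "agree X f g \<Longrightarrow> x \<notin> X \<Longrightarrow> f x = g x"
  by (simp add: agree_def)

lemma upd_same [simp]: "upd f x a y x = (f x)(a := y)"
  by (simp add: upd_def)

lemma upd_other [simp]: "z \<noteq> x \<Longrightarrow> upd f x a y z = f z"
  by (simp add: upd_def)

section \<open>The program\<close>

abbreviation NVar :: "aname \<Rightarrow> nexp" where "NVar x \<equiv> NCell x (NConst 0)"
abbreviation RVar :: "aname \<Rightarrow> rexp" where "RVar x \<equiv> RCell x (NConst 0)"

definition total_weight_and_max :: com where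
  "total_weight_and_max = For ''i'' (NVar ''n'')
     (Seq (RAssign ''T'' (NConst 0) (RPlus (RVar ''T'') (RCell ''weight'' (NVar ''i''))))
       (Cond (RLess (RVar ''M'') (RCell ''weight'' (NVar ''i'')))
         (RAssign ''M'' (NConst 0) (RCell ''weight'' (NVar ''i''))) Skip))"

definition copy_coloring :: com where
  "copy_coloring = For ''i'' (NVar ''n'') (NAssign ''out'' (NVar ''i'') (NCell ''color'' (NVar ''i'')))"

text \<open>\<open>T\<close> already holds the total weight, so subtracting the maximum once per
  color leaves the numerator of the threshold.\<close>

definition threshold :: com where
  "threshold = For ''i'' (NVar ''k'') (RAssign ''T'' (NConst 0) (RMinus (RVar ''T'') (RVar ''M'')))"

text \<open>The threshold should be $(w(V) - k \max_v w_v) / (k + \kappa)$; lacking division, the program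
  multiplies the weights by $k + \kappa$ instead.\<close>

definition scale_weights :: com where
  "scale_weights = For ''i'' (NVar ''n'') (For ''j'' (NPlus (NVar ''k'') (NVar ''kappa''))
     (RAssign ''wt'' (NVar ''i'') (RPlus (RCell ''wt'' (NVar ''i'')) (RCell ''weight'' (NVar ''i'')))))"

definition class_weights :: com where
  "class_weights = For ''i'' (NVar ''n'')
     (RAssign ''R'' (NCell ''color'' (NVar ''i''))
       (RPlus (RCell ''R'' (NCell ''color'' (NVar ''i''))) (RCell ''wt'' (NVar ''i''))))"

text \<open>Opening comes before adding, so a vertex that opens a piece also enters it. Colors start
  at 1, which leaves 0 to mean that a class has no open piece or that a vertex has no color.\<close>

definition cut_body :: com where
  "cut_body =
    (let col = NCell ''color'' (NVar ''i''); cur = NCell ''cur'' col in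
     Seq (Cond (BAnd (BAnd (NLess cur (NConst 1)) (NLess (NVar ''p'') (NVar ''k'')))
                 (BNot (RLess (RCell ''R'' col) (RVar ''T''))))
           (Seq (NAssign ''p'' (NConst 0) (NPlus (NVar ''p'') (NConst 1)))
                (NAssign ''cur'' col (NVar ''p''))) Skip)
     (Seq (Cond (NLess cur (NConst 1)) Skip
           (Seq (NAssign ''out'' (NVar ''i'') cur)
           (Seq (RAssign ''W'' cur (RPlus (RCell ''W'' cur) (RCell ''wt'' (NVar ''i''))))
                (Cond (RLess (RCell ''W'' cur) (RVar ''T'')) Skip (NAssign ''cur'' col (NConst 0))))))
       (RAssign ''R'' col (RMinus (RCell ''R'' col) (RCell ''wt'' (NVar ''i''))))))"

text \<open>While vertex \<open>i\<close> is treated, colors of its neighbors are marked by \<open>i + 1\<close> in \<open>blk\<close>, so the marks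
  need no resetting.\<close>

definition block_body :: com where
  "block_body = Cond (NLess (NConst 0) (NCell ''adj'' (NPlus (NVar ''row'') (NVar ''j''))))
     (NAssign ''blk'' (NCell ''out'' (NVar ''j'')) (NPlus (NVar ''i'') (NConst 1))) Skip"

text \<open>Loop index \<open>j\<close> stands for color \<open>j + 1\<close>, and
  \<open>best\<close> is 0 until a free color is found. The negated conjunction expresses that
  \<open>best\<close> is 0 or that the new color is strictly lighter.\<close>

definition select_body :: com where
  "select_body =
    (let c = NPlus (NVar ''j'') (NConst 1) in
     Cond (BAnd (NLess (NCell ''blk'' c) (NPlus (NVar ''i'') (NConst 1)))
            (BNot (BAnd (NLess (NConst 0) (NVar ''best''))
              (BNot (RLess (RCell ''W'' c) (RCell ''W'' (NVar ''best'')))))))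
       (NAssign ''best'' (NConst 0) c) Skip)"

definition place :: com where
  "place = Seq (NAssign ''out'' (NVar ''i'') (NVar ''best''))
     (RAssign ''W'' (NVar ''best'') (RPlus (RCell ''W'' (NVar ''best'')) (RCell ''wt'' (NVar ''i''))))"

text \<open>The offset \<open>i * n\<close> into the adjacency matrix is maintained by repeated
  addition, hence it must also advance when the vertex has been colored by the cutting.\<close>

definition fill_body :: com where
  "fill_body = Seq
     (Cond (NLess (NCell ''out'' (NVar ''i'')) (NConst 1))
       (Seq (For ''j'' (NVar ''n'') block_body)
       (Seq (NAssign ''best'' (NConst 0) (NConst 0))
       (Seq (For ''j'' (NVar ''k'') select_body) place))) Skip)
     (NAssign ''row'' (NConst 0) (NPlus (NVar ''row'') (NVar ''n'')))"

definition eq1_program :: com where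
  "eq1_program = Seq total_weight_and_max
     (Cond (RLess (RConst 0) (RVar ''T''))
       (Seq threshold (Seq scale_weights (Seq class_weights
         (Seq (For ''i'' (NVar ''n'') cut_body) (For ''i'' (NVar ''n'') fill_body)))))
       copy_coloring)"

section \<open>Correctness of the program\<close>

locale eq1_instance =
  fixes n :: nat and E :: "nat set set" and w :: "nat \<Rightarrow> rat" and \<kappa> :: nat
    and C' :: "nat \<Rightarrow> nat set" and \<epsilon> :: real and k :: nat
  assumes hyp: "eq1_hypotheses {..<n} E w \<kappa> C' \<epsilon> k"
begin

section \<open>The input as laid out in memory\<close>

definition "F = fst (input_state n E w \<kappa> C' \<epsilon> k)"
definition "G = snd (input_state n E w \<kappa> C' \<epsilon> k)"

text \<open>Extended by 0 beyond the vertices, it equals the whole array \<open>color\<close>; this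
  allows rewriting without index conditions.\<close>

definition col :: "nat \<Rightarrow> nat" where
  "col v = (if v < n then THE i. i \<in> {1..\<kappa>} \<and> v \<in> C' i else 0)"

definition wgt :: "nat \<Rightarrow> real" where
  "wgt v = (if v < n then real_of_rat (w v) else 0)"

definition S :: real where "S = sum wgt {..<n}"

text \<open>The inserted 0 covers the empty range and matches the initial memory; as weights are
  nonnegative, it does not change the maximum.\<close>

definition maxw :: "nat \<Rightarrow> real" where "maxw m = Max (insert 0 (wgt ` {..<m}))"

lemma F_simps [simp]:
  "F ''n'' 0 = n" "F ''k'' 0 = k" "F ''kappa'' 0 = \<kappa>" "F ''color'' = col"
  "m < n \<Longrightarrow> u < n \<Longrightarrow> F ''adj'' (m * n + u) = (if {u, m} \<in> E then 1 else 0)"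
  "x \<in> {''out'', ''cur'', ''p'', ''blk'', ''best'', ''row''} \<Longrightarrow> F x = (\<lambda>_. 0)"
proof -
  assume "m < n" "u < n"
  then have "m * n + u < n * n"
    by (metis add.commute add_less_cancel_left less_le_trans mult.commute mult_Suc mult_le_mono2 Suc_leI)
  then show "F ''adj'' (m * n + u) = (if {u, m} \<in> E then 1 else 0)"
    using \<open>u < n\<close> by (simp add: F_def input_state_def insert_commute)
qed (auto simp: F_def input_state_def col_def fun_eq_iff)

lemma G_simps [simp]:
  "G ''weight'' = wgt"
  "x \<in> {''T'', ''M'', ''wt'', ''R'', ''W''} \<Longrightarrow> G x = (\<lambda>_. 0)"
  by (auto simp: G_def input_state_def wgt_def fun_eq_iff)

lemma maxw_0: "maxw 0 = 0"
  by (simp add: maxw_def)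

lemma maxw_Suc: "maxw (Suc m) = max (maxw m) (wgt m)"
proof -
  have "insert 0 (wgt ` {..<Suc m}) = insert (wgt m) (insert 0 (wgt ` {..<m}))"
    by (auto simp: lessThan_Suc)
  then show ?thesis by (simp add: maxw_def max.commute)
qed

section \<open>Preprocessing: totals, threshold, scaling, class weights\<close>

definition weighed :: "nat \<Rightarrow> state \<Rightarrow> bool" where
  "weighed m s \<longleftrightarrow> agree {''i''} (fst s) F \<and> agree {''T'', ''M''} (snd s) G \<and>
     snd s ''T'' 0 = sum wgt {..<m} \<and> snd s ''M'' 0 = maxw m"

lemma total_weight_and_max:
  "terminates (weighed 0) total_weight_and_max (n * 6 + 2) (weighed n)"
proof -
  let ?c = "Seq (RAssign ''T'' (NConst 0) (RPlus (RVar ''T'') (RCell ''weight'' (NVar ''i''))))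
       (Cond (RLess (RVar ''M'') (RCell ''weight'' (NVar ''i'')))
         (RAssign ''M'' (NConst 0) (RCell ''weight'' (NVar ''i''))) Skip)"
  have "terminates (weighed 0) total_weight_and_max (n * (cost ?c + 2) + 2) (weighed n)"
    unfolding total_weight_and_max_def
  proof (rule terminates_For)
    fix m
    show "terminates (\<lambda>s. weighed m s \<and> fst s ''i'' 0 = m) ?c (cost ?c)
        (\<lambda>s. weighed (Suc m) s \<and> fst s ''i'' 0 = m)"
    proof (rule terminates_loop_free)
      fix s assume s: "weighed m s \<and> fst s ''i'' 0 = m"
      then have "snd s ''weight'' = wgt"
        using agreeD[of "{''T'', ''M''}" "snd s" G "''weight''"] by (simp add: weighed_def)
      with s show "weighed (Suc m) (exec ?c s) \<and> fst (exec ?c s) ''i'' 0 = m"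
        by (auto simp: weighed_def maxw_Suc max_def)
    qed simp
  qed (auto simp: weighed_def dest: agreeD[of _ _ _ "''n''"])
  then show ?thesis by (rule terminates_time) simp
qed

lemma copy_coloring:
  "terminates (weighed n) copy_coloring (n * 3 + 2) (\<lambda>s. \<forall>v<n. fst s ''out'' v = col v)"
proof -
  let ?I = "\<lambda>m s. agree {''i'', ''out''} (fst s) F \<and> (\<forall>v<m. fst s ''out'' v = col v)"
  let ?c = "NAssign ''out'' (NVar ''i'') (NCell ''color'' (NVar ''i''))"
  have "terminates (?I 0) copy_coloring (n * (cost ?c + 2) + 2) (?I n)"
    unfolding copy_coloring_def
  proof (rule terminates_For)
    fix m
    show "terminates (\<lambda>s. ?I m s \<and> fst s ''i'' 0 = m) ?c (cost ?c) (\<lambda>s. ?I (Suc m) s \<and> fst s ''i'' 0 = m)"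
    proof (rule terminates_loop_free)
      fix s :: state assume s: "?I m s \<and> fst s ''i'' 0 = m"
      then have "fst s ''color'' = col"
        using agreeD[of "{''i'', ''out''}" "fst s" F "''color''"] by simp
      with s show "?I (Suc m) (exec ?c s) \<and> fst (exec ?c s) ''i'' 0 = m"
        by (auto simp: less_Suc_eq)
    qed simp
  qed (auto dest: agreeD[of _ _ _ "''n''"])
  then show ?thesis
    by (rule terminates_weaken) (auto simp: weighed_def agree_def)
qed

text \<open>The threshold multiplied by \<open>k + \<kappa>\<close>, the same factor that turns
  \<open>wgt\<close> into \<open>scaled\<close>.\<close>

definition Tv :: real where "Tv = S - real k * maxw n"

definition scaled :: "nat \<Rightarrow> real" where "scaled v = real (k + \<kappa>) * wgt v"

lemma threshold:
  "terminates (weighed n) threshold (k * 3 + 2)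
     (\<lambda>s. agree {''i''} (fst s) F \<and> agree {''T'', ''M''} (snd s) G \<and> snd s ''T'' 0 = Tv)"
proof -
  let ?I = "\<lambda>m s. agree {''i''} (fst s) F \<and> agree {''T'', ''M''} (snd s) G \<and>
    snd s ''T'' 0 = S - real m * maxw n \<and> snd s ''M'' 0 = maxw n"
  let ?c = "RAssign ''T'' (NConst 0) (RMinus (RVar ''T'') (RVar ''M''))"
  have "terminates (?I 0) threshold (k * (cost ?c + 2) + 2) (?I k)"
    unfolding threshold_def
  proof (rule terminates_For)
    fix m
    show "terminates (\<lambda>s. ?I m s \<and> fst s ''i'' 0 = m) ?c (cost ?c) (\<lambda>s. ?I (Suc m) s \<and> fst s ''i'' 0 = m)"
      by (rule terminates_loop_free) (auto simp: algebra_simps)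
  qed (auto dest: agreeD[of _ _ _ "''k''"])
  then show ?thesis
    by (rule terminates_weaken) (auto simp: weighed_def Tv_def S_def)
qed

definition scaling :: "nat \<Rightarrow> state \<Rightarrow> bool" where
  "scaling m s \<longleftrightarrow> agree {''i'', ''j''} (fst s) F \<and> agree {''T'', ''M'', ''wt''} (snd s) G \<and>
     snd s ''T'' 0 = Tv \<and> snd s ''wt'' = (\<lambda>v. if v < m then scaled v else 0)"

lemma scale_weights:
  "terminates (scaling 0) scale_weights (n * ((k + \<kappa>) * 3 + 4) + 2) (scaling n)"
proof -
  let ?c = "RAssign ''wt'' (NVar ''i'') (RPlus (RCell ''wt'' (NVar ''i'')) (RCell ''weight'' (NVar ''i'')))"
  have "terminates (scaling 0) scale_weights (n * ((k + \<kappa>) * (cost ?c + 2) + 2 + 2) + 2) (scaling n)"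
    unfolding scale_weights_def
  proof (rule terminates_For)
    fix m
    let ?J = "\<lambda>l s. agree {''i'', ''j''} (fst s) F \<and> agree {''T'', ''M'', ''wt''} (snd s) G \<and>
      snd s ''T'' 0 = Tv \<and> fst s ''i'' 0 = m \<and>
      snd s ''wt'' = (\<lambda>v. if v < m then scaled v else if v = m then real l * wgt v else 0)"
    have "terminates (?J 0) (For ''j'' (NPlus (NVar ''k'') (NVar ''kappa'')) ?c)
        ((k + \<kappa>) * (cost ?c + 2) + 2) (?J (k + \<kappa>))"
    proof (rule terminates_For)
      fix l
      show "terminates (\<lambda>s. ?J l s \<and> fst s ''j'' 0 = l) ?c (cost ?c) (\<lambda>s. ?J (Suc l) s \<and> fst s ''j'' 0 = l)"
      proof (rule terminates_loop_free)
        fix s assume s: "?J l s \<and> fst s ''j'' 0 = l"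
        then have "snd s ''weight'' = wgt"
          using agreeD[of "{''T'', ''M'', ''wt''}" "snd s" G "''weight''"] by simp
        with s show "?J (Suc l) (exec ?c s) \<and> fst (exec ?c s) ''j'' 0 = l"
          by (auto simp: fun_eq_iff algebra_simps)
      qed simp
    qed (auto simp: agreeD[of "{''i'', ''j''}" _ F])
    then show "terminates (\<lambda>s. scaling m s \<and> fst s ''i'' 0 = m)
       (For ''j'' (NPlus (NVar ''k'') (NVar ''kappa'')) ?c) ((k + \<kappa>) * (cost ?c + 2) + 2)
       (\<lambda>s. scaling (Suc m) s \<and> fst s ''i'' 0 = m)"
      by (rule terminates_weaken) (auto simp: scaling_def scaled_def fun_eq_iff)
  qed (auto simp: scaling_def dest: agreeD[of _ _ _ "''n''"])
  then show ?thesis by (rule terminates_time) (simp add: algebra_simps)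
qed

definition wt :: "nat \<Rightarrow> real" where "wt v = (if v < n then scaled v else 0)"

definition classes :: "nat \<Rightarrow> state \<Rightarrow> bool" where
  "classes m s \<longleftrightarrow> agree {''i'', ''j''} (fst s) F \<and> agree {''T'', ''M'', ''wt'', ''R''} (snd s) G \<and>
     snd s ''T'' 0 = Tv \<and> snd s ''wt'' = wt \<and>
     snd s ''R'' = (\<lambda>c. \<Sum>v | v < m \<and> col v = c. wt v)"

lemma class_weights:
  "terminates (scaling n) class_weights (n * 3 + 2) (classes n)"
proof -
  let ?c = "RAssign ''R'' (NCell ''color'' (NVar ''i''))
       (RPlus (RCell ''R'' (NCell ''color'' (NVar ''i''))) (RCell ''wt'' (NVar ''i'')))"
  have "terminates (classes 0) class_weights (n * (cost ?c + 2) + 2) (classes n)"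
    unfolding class_weights_def
  proof (rule terminates_For)
    fix m
    show "terminates (\<lambda>s. classes m s \<and> fst s ''i'' 0 = m) ?c (cost ?c)
        (\<lambda>s. classes (Suc m) s \<and> fst s ''i'' 0 = m)"
    proof (rule terminates_loop_free)
      fix s assume s: "classes m s \<and> fst s ''i'' 0 = m"
      then have col: "fst s ''color'' = col"
        using agreeD[of "{''i'', ''j''}" "fst s" F "''color''"] by (simp add: classes_def)
      have "{v. v < Suc m \<and> col v = c} = (if col m = c then insert m else id) {v. v < m \<and> col v = c}" for c
        by (auto simp: less_Suc_eq)
      then have "(\<lambda>c. \<Sum>v | v < Suc m \<and> col v = c. wt v) = (\<lambda>c. \<Sum>v | v < m \<and> col v = c. wt v)
          (col m := (\<Sum>v | v < m \<and> col v = col m. wt v) + wt m)"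
        by (auto simp: fun_eq_iff)
      with s col show "classes (Suc m) (exec ?c s) \<and> fst (exec ?c s) ''i'' 0 = m"
        by (simp add: classes_def)
    qed simp
  qed (auto simp: classes_def dest: agreeD[of _ _ _ "''n''"])
  moreover have "classes 0 s" if "scaling n s" for s
    using that agreeD[of "{''T'', ''M'', ''wt''}" "snd s" G "''R''"]
      agree_mono[of "{''T'', ''M'', ''wt''}" "snd s" G "{''T'', ''M'', ''wt'', ''R''}"]
    by (simp add: classes_def scaling_def wt_def[abs_def] subset_insertI2)
  ultimately show ?thesis by (rule terminates_weaken) simp_all
qed

section \<open>Consequences of the hypotheses\<close>

lemma
  shows k_pos: "0 < k" and eps_pos: "0 < \<epsilon>" and eps_le: "\<epsilon> \<le> 1 / 10"
    and kappa_le: "real \<kappa> \<le> \<epsilon> * real k"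
    and edge_vertex: "{u, v} \<in> E \<Longrightarrow> u < n"
    and degree_le: "v < n \<Longrightarrow> 2 * card {u. {u, v} \<in> E} \<le> k"
    and wgt_nonneg: "0 \<le> wgt v"
    and S_eq: "S = real_of_rat (weight w {..<n})"
    and wgt_le: "v < n \<Longrightarrow> real k * wgt v \<le> \<epsilon> * S"
proof -
  have *: "\<forall>e\<in>E. e \<subseteq> {..<n} \<and> card e = 2" "\<forall>v\<in>{..<n}. 0 \<le> w v" "0 < \<epsilon>" "\<epsilon> \<le> 1 / 10" "0 < k"
    "real \<kappa> / \<epsilon> \<le> real k" "2 * real (max_degree {..<n} E) \<le> real k"
    "\<forall>v\<in>{..<n}. real_of_rat (w v) \<le> \<epsilon> * (real_of_rat (weight w {..<n}) / real k)"
    using hyp by (auto simp: eq1_hypotheses_def simple_graph_def)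
  from * show "0 < k" "0 < \<epsilon>" "\<epsilon> \<le> 1 / 10" by auto
  from * show "real \<kappa> \<le> \<epsilon> * real k" by (simp add: field_simps)
  from * show "{u, v} \<in> E \<Longrightarrow> u < n" by auto
  from * show "0 \<le> wgt v" by (simp add: wgt_def)
  show S_eq: "S = real_of_rat (weight w {..<n})"
    by (simp add: S_def wgt_def weight_def of_rat_sum)
  from * show "real k * wgt v \<le> \<epsilon> * S" if "v < n"
    using that by (simp add: S_eq wgt_def field_simps)
  show "2 * card {u. {u, v} \<in> E} \<le> k" if "v < n"
  proof -
    have "degree E v \<le> max_degree {..<n} E"
      unfolding max_degree_def using that by (intro cSUP_upper) auto
    then show ?thesis using *(7) unfolding degree_def by linarith
  qed
qed

lemma kappa_le_k: "\<kappa> \<le> k"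
proof -
  have "\<epsilon> * real k \<le> 1 * real k" using eps_le by (intro mult_right_mono) auto
  with kappa_le show ?thesis by linarith
qed

lemma col_eq:
  assumes "v < n"
  shows "col v \<in> {1..\<kappa>} \<and> v \<in> C' (col v)"
proof -
  have "is_coloring {..<n} E \<kappa> C'" using hyp by (simp add: eq1_hypotheses_def)
  then have U: "(\<Union>i\<in>{1..\<kappa>}. C' i) = {..<n}" and D: "disjoint_family_on C' {1..\<kappa>}"
    by (auto simp: is_coloring_def)
  from U assms obtain i where i: "i \<in> {1..\<kappa>}" "v \<in> C' i" by blast
  moreover have "j = i" if "j \<in> {1..\<kappa>} \<and> v \<in> C' j" for j
    using that i D unfolding disjoint_family_on_def by blast
  ultimately have "\<exists>!i. i \<in> {1..\<kappa>} \<and> v \<in> C' i" by blast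
  from theI'[OF this] show ?thesis using assms by (simp add: col_def)
qed

lemma col_proper:
  assumes "{u, v} \<in> E"
  shows "col u \<noteq> col v"
proof
  assume "col u = col v"
  moreover have "u < n" "v < n" using assms edge_vertex[of u v] edge_vertex[of v u] by (auto simp: insert_commute)
  ultimately have "u \<in> C' (col v)" "v \<in> C' (col v)" "col v \<in> {1..\<kappa>}" using col_eq by metis+
  moreover have "independent_set E (C' (col v))"
    using hyp \<open>col v \<in> {1..\<kappa>}\<close> by (auto simp: eq1_hypotheses_def is_coloring_def)
  ultimately show False using assms by (auto simp: independent_set_def)
qed

lemma S_nonneg: "0 \<le> S"
  unfolding S_def using wgt_nonneg by (intro sum_nonneg) auto

lemma maxw_nonneg: "0 \<le> maxw n"
  unfolding maxw_def by (intro Max_ge) auto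

lemma wgt_le_maxw: "v < n \<Longrightarrow> wgt v \<le> maxw n"
  unfolding maxw_def by (intro Max_ge) auto

lemma maxw_le: "real k * maxw n \<le> \<epsilon> * S"
proof -
  have "maxw n \<in> insert 0 (wgt ` {..<n})"
    unfolding maxw_def by (intro Max_in) auto
  then show ?thesis using wgt_le eps_pos S_nonneg by auto
qed

section \<open>From the output array to an EQ1 coloring\<close>

lemma is_coloring_output:
  assumes "\<And>v. v < n \<Longrightarrow> fst s ''out'' v \<in> {1..k}"
    and "\<And>u v. {u, v} \<in> E \<Longrightarrow> fst s ''out'' u \<noteq> fst s ''out'' v"
  shows "is_coloring {..<n} E k (output_coloring n s)"
  using assms
  by (fastforce simp: is_coloring_def output_coloring_def disjoint_family_on_def independent_set_def)

lemma weight_output: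
  "real_of_rat (weight w (output_coloring n s i)) = (\<Sum>v | v < n \<and> fst s ''out'' v = i. wgt v)"
  unfolding weight_def output_coloring_def of_rat_sum by (intro sum.cong) (auto simp: wgt_def)

text \<open>Weights are nonnegative, so removing a vertex cannot increase the weight of a color:
  once whole colors compare, any of its vertices is a witness.\<close>

lemma is_EQ1_I:
  assumes "\<And>i j. i \<in> {1..k} \<Longrightarrow> j \<in> {1..k} \<Longrightarrow>
    real_of_rat (weight w (output_coloring n s i)) \<le> \<alpha> * real_of_rat (weight w (output_coloring n s j))"
  shows "is_EQ1 w \<alpha> k (output_coloring n s)"
  unfolding is_EQ1_def
proof (intro ballI impI)
  fix i j assume ij: "i \<in> {1..k}" "j \<in> {1..k}" and "output_coloring n s i \<noteq> {}"
  then obtain v where v: "v \<in> output_coloring n s i" by blast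
  have "0 \<le> w u" if "u < n" for u
    using hyp that by (auto simp: eq1_hypotheses_def)
  then have "weight w (output_coloring n s i - {v}) \<le> weight w (output_coloring n s i)"
    unfolding weight_def by (intro sum_mono2) (auto simp: output_coloring_def)
  then have "real_of_rat (weight w (output_coloring n s i - {v})) \<le> real_of_rat (weight w (output_coloring n s i))"
    by (simp only: of_rat_less_eq)
  then show "\<exists>v\<in>output_coloring n s i. real_of_rat (weight w (output_coloring n s i - {v})) \<le>
      \<alpha> * real_of_rat (weight w (output_coloring n s j))"
    using assms[OF ij] v by (intro bexI[of _ v]) linarith
qed

end

section \<open>Positive total weight and the ratio 1 + 7\<epsilon>\<close>

locale eq1_positive_instance = eq1_instance +
  assumes S_pos: "0 < S"
begin

text \<open>Summing \<open>k * wgt v \<le> \<epsilon> * S\<close> over all vertices and cancelling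
  \<open>S\<close> gives \<open>k \<le> \<epsilon> * n\<close>. This is what makes loops over the
  colors polynomial in \<open>n\<close>.\<close>

lemma k_le_n: "k \<le> n"
proof -
  have "real k * S = (\<Sum>v<n. real k * wgt v)" by (simp add: S_def sum_distrib_left)
  also have "\<dots> \<le> of_nat (card {..<n}) * (\<epsilon> * S)" using wgt_le by (intro sum_bounded_above) auto
  finally have "real k * S \<le> (real n * \<epsilon>) * S" by simp
  then have "real k \<le> real n * \<epsilon>" using S_pos by simp
  also have "\<dots> \<le> real n * 1" using eps_le by (intro mult_left_mono) auto
  finally show ?thesis by simp
qed

lemma Tv_pos: "0 < Tv"
proof -
  have "\<epsilon> * S < 1 * S" using eps_le S_pos by (intro mult_strict_right_mono) auto
  then show ?thesis using maxw_le by (simp add: Tv_def)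
qed

definition Ms :: real where "Ms = real (k + \<kappa>) * maxw n"

sublocale piece_cutting n k \<kappa> E col wt Tv Ms
  unfolding Ms_def
proof
  show "0 \<le> wt v" for v using wgt_nonneg by (simp add: wt_def scaled_def)
  show "wt v \<le> real (k + \<kappa>) * maxw n" if "v < n" for v
    using that wgt_le_maxw[OF that] by (auto simp: wt_def scaled_def intro!: mult_left_mono)
  show "0 \<le> real (k + \<kappa>) * maxw n" using maxw_nonneg by simp
  have "sum wt {..<n} = real (k + \<kappa>) * S"
    by (simp add: S_def wt_def scaled_def sum_distrib_left)
  \<comment> \<open>By the choice of \<open>Tv\<close> this holds with equality.\<close>
  then show "real (k + \<kappa>) * Tv + real k * (real (k + \<kappa>) * maxw n) \<le> sum wt {..<n}"
    by (simp add: Tv_def algebra_simps)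
qed (use Tv_pos k_pos col_eq col_proper edge_vertex degree_le in auto)

lemma balanced:
  assumes "filling n out W" and ij: "i \<in> {1..k}" "j \<in> {1..k}"
  shows "(\<Sum>v | v < n \<and> out v = i. wgt v) \<le> (1 + 7 * \<epsilon>) * (\<Sum>v | v < n \<and> out v = j. wgt v)"
proof -
  let ?K = "real (k + \<kappa>)"
  let ?x = "\<Sum>v | v < n \<and> out v = i. wgt v" and ?y = "\<Sum>v | v < n \<and> out v = j. wgt v"
  have K: "0 < ?K" "0 < real k" using k_pos by auto
  have load: "load out l = ?K * (\<Sum>v | v < n \<and> out v = l. wgt v)" for l
    unfolding load_def sum_distrib_left by (intro sum.cong) (auto simp: wt_def scaled_def)
  have sum_wt: "sum wt {..<n} = ?K * S"
    by (simp add: S_def wt_def scaled_def sum_distrib_left)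
  \<comment> \<open>Undo the scaling: \<open>A\<close> is the average color weight and
    \<open>t\<close> the actual threshold.\<close>
  define A where "A = S / real k"
  define t where "t = Tv / ?K"
  have A: "0 < A" "S = real k * A" using S_pos K by (auto simp: A_def)
  have t: "Tv = ?K * t" using K by (simp add: t_def)
  have "Tv \<le> load out j" "real k * (load out i + Tv) \<le> 2 * sum wt {..<n} + real k * Ms"
    using assms unfolding filling_def by metis+
  then have "?K * t \<le> ?K * ?y" "?K * (real k * (?x + t)) \<le> ?K * (real k * (2 * A + maxw n))"
    by (simp_all add: load sum_wt t A Ms_def algebra_simps)
  then have y: "t \<le> ?y" and x: "?x + t \<le> 2 * A + maxw n"
    using K by auto
  have m: "maxw n \<le> \<epsilon> * A"
    using maxw_le K by (simp add: A_def field_simps)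
  \<comment> \<open>Two estimates of \<open>Tv\<close> bring \<open>t\<close> close to
    \<open>A\<close>: the maximum weight bounds it below, and
    \<open>k + \<kappa> \<le> (1 + \<epsilon>) * k\<close> bounds it above in terms of
    \<open>t\<close>.\<close>
  have "real k * ((1 - \<epsilon>) * A) \<le> Tv"
    using maxw_le A by (simp add: Tv_def algebra_simps)
  also have "\<dots> \<le> (1 + \<epsilon>) * real k * t"
    unfolding t using kappa_le Tv_pos K by (intro mult_right_mono) (auto simp: algebra_simps t_def)
  finally have "real k * ((1 - \<epsilon>) * A) \<le> real k * ((1 + \<epsilon>) * t)" by (simp add: algebra_simps)
  then have tA: "(1 - \<epsilon>) * A \<le> (1 + \<epsilon>) * t" using K by auto
  \<comment> \<open>Origin of the 7:
    \<open>(1 + \<epsilon>) * (2 + \<epsilon>) / (1 - \<epsilon>)\<close> is 2 + 5\<epsilon> up to a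
    quadratic term, and a further 2\<epsilon> absorbs that term. Cross-multiplied, the claim is that
    8\<epsilon>\<epsilon> is at most 2\<epsilon>. Subtracting \<open>t\<close> later turns 2 +
    7\<epsilon> into 1 + 7\<epsilon>.\<close>
  have "(1 + \<epsilon>) * ((2 + \<epsilon>) * A) \<le> (2 + 7 * \<epsilon>) * ((1 - \<epsilon>) * A)"
  proof -
    have "8 * \<epsilon> * \<epsilon> \<le> 2 * \<epsilon>" using eps_pos eps_le by simp
    then have "(1 + \<epsilon>) * (2 + \<epsilon>) \<le> (2 + 7 * \<epsilon>) * (1 - \<epsilon>)" by (simp add: algebra_simps)
    then show ?thesis using A by (metis mult.assoc mult_right_mono less_imp_le)
  qed
  also have "\<dots> \<le> (2 + 7 * \<epsilon>) * ((1 + \<epsilon>) * t)"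
    using tA eps_pos by (intro mult_left_mono) auto
  finally have "(1 + \<epsilon>) * ((2 + \<epsilon>) * A) \<le> (1 + \<epsilon>) * ((2 + 7 * \<epsilon>) * t)" by (simp add: algebra_simps)
  then have "(2 + \<epsilon>) * A \<le> (2 + 7 * \<epsilon>) * t" using eps_pos by (simp add: mult_le_cancel_left)
  then have "?x \<le> (1 + 7 * \<epsilon>) * t" using x m by (simp add: algebra_simps)
  also have "\<dots> \<le> (1 + 7 * \<epsilon>) * ?y" using y eps_pos by (intro mult_left_mono) auto
  finally show ?thesis .
qed

section \<open>The cutting loop\<close>

definition cut_state :: "nat \<Rightarrow> state \<Rightarrow> bool" where
  "cut_state m s \<longleftrightarrow> agree {''i'', ''j'', ''out'', ''cur'', ''p''} (fst s) F \<and>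
     agree {''T'', ''M'', ''wt'', ''R'', ''W''} (snd s) G \<and>
     snd s ''T'' 0 = Tv \<and> snd s ''wt'' = wt \<and>
     cutting m (fst s ''out'') (fst s ''p'' 0) (fst s ''cur'') (snd s ''W'') (snd s ''R'')"

lemma cut_state_init: "classes n s \<Longrightarrow> cut_state 0 s"
proof -
  assume s: "classes n s"
  then have "snd s ''R'' = remaining 0"
    by (simp add: classes_def remaining_def[abs_def])
  moreover have "fst s x = (\<lambda>_. 0)" if "x \<in> {''out'', ''cur'', ''p''}" for x
    using s that agreeD[of "{''i'', ''j''}" "fst s" F x] by (auto simp: classes_def)
  moreover have "snd s ''W'' = (\<lambda>_. 0)"
    using s agreeD[of "{''T'', ''M'', ''wt'', ''R''}" "snd s" G "''W''"] by (simp add: classes_def)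
  moreover have "agree {''i'', ''j'', ''out'', ''cur'', ''p''} (fst s) F"
    by (rule agree_mono[of "{''i'', ''j''}"]) (use s in \<open>auto simp: classes_def\<close>)
  moreover have "agree {''T'', ''M'', ''wt'', ''R'', ''W''} (snd s) G"
    by (rule agree_mono[of "{''T'', ''M'', ''wt'', ''R''}"]) (use s in \<open>auto simp: classes_def\<close>)
  ultimately show ?thesis
    using s cutting_init by (simp add: cut_state_def classes_def)
qed

text \<open>A round is \<open>cutting_add\<close> if the class has an open piece,
  \<open>cutting_open\<close> followed by \<open>cutting_add\<close> if a piece can be started, and
  \<open>cutting_skip\<close> otherwise.\<close>

lemma cut_body:
  assumes "m < n" and s: "cut_state m s" "fst s ''i'' 0 = m"
  shows "cut_state (Suc m) (exec cut_body s) \<and> fst (exec cut_body s) ''i'' 0 = m"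
proof -
  let ?out = "fst s ''out''" and ?p = "fst s ''p'' 0" and ?cur = "fst s ''cur''"
    and ?W = "snd s ''W''" and ?R = "snd s ''R''" and ?c = "col m"
  have col: "fst s ''color'' = col" and k: "fst s ''k'' 0 = k"
    using s(1) agreeD[of "{''i'', ''j'', ''out'', ''cur'', ''p''}" "fst s" F]
    by (simp_all add: cut_state_def)
  have T: "snd s ''T'' 0 = Tv" and wt: "snd s ''wt'' = wt"
    and agree: "agree {''i'', ''j'', ''out'', ''cur'', ''p''} (fst s) F"
      "agree {''T'', ''M'', ''wt'', ''R'', ''W''} (snd s) G"
    and cut: "cutting m ?out ?p ?cur ?W ?R"
    using s(1) by (auto simp: cut_state_def)
  note simps = cut_body_def Let_def col k T wt s(2) cut_state_def agree
  show ?thesis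
  proof (cases "?cur ?c = 0")
    case False
    then show ?thesis
      using cutting_add[OF cut assms(1) refl False]
      by (cases "?W (?cur ?c) + wt m < Tv") (simp_all add: simps, auto simp: fun_upd_def cong: if_cong)
  next
    case True
    note cur = True
    show ?thesis
    proof (cases "?p < k \<and> Tv \<le> ?R ?c")
      case True
      with cutting_open[OF cut cur]
      have open': "cutting m ?out (Suc ?p) (?cur(?c := Suc ?p)) ?W ?R" by blast
      show ?thesis
        using cutting_add[OF open' assms(1) refl] True cur
        by (cases "?W (Suc ?p) + wt m < Tv") (simp_all add: simps, auto simp: fun_upd_def cong: if_cong)
    next
      case False
      then have "?R ?c < Tv \<or> ?p = k" using cut_p[OF cut] by auto
      from cutting_skip[OF cut assms(1) refl cur this] False cur
      show ?thesis by (auto simp: simps)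
    qed
  qed
qed

lemma loop_free_cut_body: "loop_free cut_body" and cost_cut_body: "cost cut_body = 12"
  by (simp_all add: cut_body_def Let_def)

lemma cut_state_n: "cut_state m s \<Longrightarrow> fst s ''n'' 0 = n"
  using agreeD[of "{''i'', ''j'', ''out'', ''cur'', ''p''}" "fst s" F "''n''"] by (simp add: cut_state_def)

lemma cut_loop: "terminates (classes n) (For ''i'' (NVar ''n'') cut_body) (n * 14 + 2) (cut_state n)"
proof -
  have "terminates (cut_state 0) (For ''i'' (NVar ''n'') cut_body) (n * (cost cut_body + 2) + 2) (cut_state n)"
  proof (rule terminates_For)
    show "terminates (\<lambda>s. cut_state m s \<and> fst s ''i'' 0 = m) cut_body (cost cut_body)
        (\<lambda>s. cut_state (Suc m) s \<and> fst s ''i'' 0 = m)" if "m < n" for m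
      using cut_body[OF that] loop_free_cut_body by (intro terminates_loop_free) blast+
  qed (simp_all add: cut_state_n, simp add: cut_state_def)
  then show ?thesis
    by (rule terminates_weaken) (simp_all add: cut_state_init cost_cut_body)
qed

section \<open>The filling loop\<close>

definition fill_state :: "nat \<Rightarrow> state \<Rightarrow> bool" where
  "fill_state m s \<longleftrightarrow>
     agree {''i'', ''j'', ''out'', ''cur'', ''p'', ''blk'', ''best'', ''row''} (fst s) F \<and>
     snd s ''wt'' = wt \<and> fst s ''row'' 0 = m * n \<and> (\<forall>c. fst s ''blk'' c \<le> m) \<and>
     filling m (fst s ''out'') (snd s ''W'')"

lemma fill_state_init: "cut_state n s \<Longrightarrow> fill_state 0 s"
proof -
  assume s: "cut_state n s"
  have "fst s x = (\<lambda>_. 0)" if "x \<in> {''row'', ''blk''}" for x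
    using s that agreeD[of "{''i'', ''j'', ''out'', ''cur'', ''p''}" "fst s" F x]
    by (auto simp: cut_state_def)
  moreover have "agree {''i'', ''j'', ''out'', ''cur'', ''p'', ''blk'', ''best'', ''row''} (fst s) F"
    by (rule agree_mono[of "{''i'', ''j'', ''out'', ''cur'', ''p''}"]) (use s in \<open>auto simp: cut_state_def\<close>)
  ultimately show ?thesis
    using s filling_init by (auto simp: fill_state_def cut_state_def)
qed

lemma fill_state_n: "fill_state m s \<Longrightarrow> fst s ''n'' 0 = n"
  using agreeD[of "{''i'', ''j'', ''out'', ''cur'', ''p'', ''blk'', ''best'', ''row''}" "fst s" F "''n''"]
  by (simp add: fill_state_def)

text \<open>Neighbors without a color mark cell 0, which is harmless because the search inspects
  only positive colors.\<close>

lemma block_loop: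
  assumes m: "m < n" and s: "fill_state m s" "fst s ''i'' 0 = m"
  shows "terminates (\<lambda>s'. s' = s) (For ''j'' (NVar ''n'') block_body) (n * 5 + 2)
    (\<lambda>s'. agree {''j'', ''blk''} (fst s') (fst s) \<and> snd s' = snd s \<and>
       (\<forall>c. fst s' ''blk'' c \<le> Suc m) \<and>
       (\<forall>c. fst s' ''blk'' c = Suc m \<longleftrightarrow> c \<in> fst s ''out'' ` {u. {u, m} \<in> E}))"
proof -
  let ?I = "\<lambda>l s'. agree {''j'', ''blk''} (fst s') (fst s) \<and> snd s' = snd s \<and>
       (\<forall>c. fst s' ''blk'' c \<le> Suc m) \<and>
       (\<forall>c. fst s' ''blk'' c = Suc m \<longleftrightarrow> c \<in> fst s ''out'' ` {u. u < l \<and> {u, m} \<in> E})"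
  have s_F: "fst s ''n'' 0 = n" "fst s ''adj'' = F ''adj''" "fst s ''row'' 0 = m * n"
    using s(1) agreeD[of "{''i'', ''j'', ''out'', ''cur'', ''p'', ''blk'', ''best'', ''row''}" "fst s" F]
    by (simp_all add: fill_state_def)
  have "terminates (?I 0) (For ''j'' (NVar ''n'') block_body) (n * (cost block_body + 2) + 2) (?I n)"
  proof (rule terminates_For)
    fix l assume l: "l < n"
    show "terminates (\<lambda>s'. ?I l s' \<and> fst s' ''j'' 0 = l) block_body (cost block_body)
        (\<lambda>s'. ?I (Suc l) s' \<and> fst s' ''j'' 0 = l)"
    proof (rule terminates_loop_free)
      fix s' :: state assume s': "?I l s' \<and> fst s' ''j'' 0 = l"
      then have eq: "fst s' x = fst s x" if "x \<in> {''n'', ''adj'', ''row'', ''out'', ''i''}" for x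
        using that agreeD[of "{''j'', ''blk''}" "fst s'" "fst s" x] by auto
      have "{u. u < Suc l \<and> {u, m} \<in> E} =
          (if {l, m} \<in> E then insert l else id) {u. u < l \<and> {u, m} \<in> E}"
        by (auto simp: less_Suc_eq)
      then show "?I (Suc l) (exec block_body s') \<and> fst (exec block_body s') ''j'' 0 = l"
        using s' l m by (auto simp: block_body_def eq s_F s(2))
    qed (simp add: block_body_def)
  qed (auto simp: agreeD[of "{''j'', ''blk''}" _ "fst s"] s_F)
  moreover have "{u. u < n \<and> {u, m} \<in> E} = {u. {u, m} \<in> E}"
    by (auto dest: edge_vertex)
  moreover have "?I 0 s"
  proof -
    \<comment> \<open>Marks from earlier rounds are at most \<open>m\<close>, so none of them is
      mistaken for a mark of this round.\<close>
    have "fst s ''blk'' c \<le> m" for c using s(1) by (simp add: fill_state_def)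
    then have "fst s ''blk'' c \<noteq> Suc m" "fst s ''blk'' c \<le> Suc m" for c
      by (metis Suc_n_not_le_n, metis le_SucI)
    then show ?thesis by (simp add: agree_def)
  qed
  ultimately show ?thesis
    by (elim terminates_weaken) (auto simp: block_body_def)
qed

definition lightest :: "nat \<Rightarrow> (nat \<Rightarrow> real) \<Rightarrow> nat set \<Rightarrow> nat \<Rightarrow> bool" where
  "lightest b W X l \<longleftrightarrow>
     (if b = 0 then {1..l} \<subseteq> X else b \<in> {1..l} - X \<and> (\<forall>j\<in>{1..l} - X. W b \<le> W j))"

lemma lightest_0: "lightest 0 W X 0"
  by (simp add: lightest_def)

lemma lightest_Suc:
  assumes "lightest b W X l"
  shows "lightest (if Suc l \<notin> X \<and> (b = 0 \<or> W (Suc l) < W b) then Suc l else b) W X (Suc l)"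
proof -
  have *: "{1..Suc l} = insert (Suc l) {1..l}" by auto
  show ?thesis using assms unfolding lightest_def * by (auto split: if_splits) force+
qed

lemma select_loop:
  assumes "fst s ''k'' 0 = k" "fst s ''i'' 0 = m" "fst s ''best'' 0 = 0"
    and blk: "\<And>c. fst s ''blk'' c \<le> Suc m" "\<And>c. fst s ''blk'' c = Suc m \<longleftrightarrow> c \<in> X"
  shows "terminates (\<lambda>s'. s' = s) (For ''j'' (NVar ''k'') select_body) (k * 5 + 2)
    (\<lambda>s'. agree {''j'', ''best''} (fst s') (fst s) \<and> snd s' = snd s \<and>
       lightest (fst s' ''best'' 0) (snd s ''W'') X k)"
proof -
  let ?I = "\<lambda>l s'. agree {''j'', ''best''} (fst s') (fst s) \<and> snd s' = snd s \<and>
       lightest (fst s' ''best'' 0) (snd s ''W'') X l"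
  have "terminates (?I 0) (For ''j'' (NVar ''k'') select_body) (k * (cost select_body + 2) + 2) (?I k)"
  proof (rule terminates_For)
    fix l assume l: "l < k"
    show "terminates (\<lambda>s'. ?I l s' \<and> fst s' ''j'' 0 = l) select_body (cost select_body)
        (\<lambda>s'. ?I (Suc l) s' \<and> fst s' ''j'' 0 = l)"
    proof (rule terminates_loop_free)
      fix s' :: state assume s': "?I l s' \<and> fst s' ''j'' 0 = l"
      then have eq: "fst s' x = fst s x" if "x \<in> {''k'', ''i'', ''blk''}" for x
        using that agreeD[of "{''j'', ''best''}" "fst s'" "fst s" x] by auto
      have free: "fst s ''blk'' c < Suc m \<longleftrightarrow> c \<notin> X" for c
        using blk(1)[of c] blk(2)[of c] by auto
      show "?I (Suc l) (exec select_body s') \<and> fst (exec select_body s') ''j'' 0 = l"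
        using s' lightest_Suc[of "fst s' ''best'' 0" "snd s ''W''" X l]
        by (auto simp: select_body_def Let_def eq free assms(2))
    qed (simp add: select_body_def Let_def)
  qed (auto simp: agreeD[of "{''j'', ''best''}" _ "fst s"] assms(1))
  then show ?thesis
    by (rule terminates_weaken) (simp_all add: select_body_def Let_def agree_refl lightest_0 assms(3))
qed

text \<open>The row update is included because \<open>fill_state (Suc m)\<close> holds only after
  it.\<close>

lemma place:
  assumes m: "m < n" and s: "fill_state m s" "fst s ''i'' 0 = m" "fst s ''out'' m = 0"
    and s': "agree {''j'', ''blk'', ''best''} (fst s') (fst s)" "snd s' = snd s"
      "\<And>c. fst s' ''blk'' c \<le> Suc m"
      "lightest (fst s' ''best'' 0) (snd s ''W'') (fst s ''out'' ` {u. {u, m} \<in> E}) k"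
    and s'': "s'' = exec (Seq place (NAssign ''row'' (NConst 0) (NPlus (NVar ''row'') (NVar ''n'')))) s'"
  shows "fill_state (Suc m) s'' \<and> fst s'' ''i'' 0 = m"
proof -
  let ?X = "fst s ''out'' ` {u. {u, m} \<in> E}" and ?b = "fst s' ''best'' 0"
  have eq: "fst s' x = fst s x" if "x \<in> {''n'', ''i'', ''out'', ''row''}" for x
    using that s'(1) agreeD[of "{''j'', ''blk'', ''best''}" "fst s'" "fst s" x] by auto
  have n: "fst s ''n'' 0 = n"
    using s(1) agreeD[of "{''i'', ''j'', ''out'', ''cur'', ''p'', ''blk'', ''best'', ''row''}" "fst s" F]
    by (simp add: fill_state_def)
  have "agree {''i'', ''j'', ''out'', ''cur'', ''p'', ''blk'', ''best'', ''row''} (fst s') F"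
    using s(1) s'(1) by (simp add: fill_state_def agree_def)
  \<comment> \<open>At least half of a positive number of colors are free, so the search cannot have
    ended with 0.\<close>
  moreover have "{1..k} - ?X \<noteq> {}"
    using card_available[OF m, of "fst s ''out''"] k_pos by (metis card.empty mult_0_right not_le)
  then have "?b \<in> {1..k} - ?X" "\<And>j. j \<in> {1..k} - ?X \<Longrightarrow> snd s ''W'' ?b \<le> snd s ''W'' j"
    using s'(4) by (auto simp: lightest_def split: if_splits)
  then have "filling (Suc m) ((fst s ''out'')(m := ?b)) ((snd s ''W'')(?b := snd s ''W'' ?b + wt m))"
    using s(1,3) m by (intro filling_add) (auto simp: fill_state_def)
  ultimately show ?thesis
    using s(1) s'(2,3) unfolding s''
    by (simp add: place_def fill_state_def eq s(2) n add.commute fun_upd_def)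
qed

lemma fill_body:
  assumes m: "m < n"
  shows "terminates (\<lambda>s. fill_state m s \<and> fst s ''i'' 0 = m) fill_body (5 * n + 5 * k + 9)
    (\<lambda>s. fill_state (Suc m) s \<and> fst s ''i'' 0 = m)"
proof (rule terminates_fix)
  fix s assume "fill_state m s \<and> fst s ''i'' 0 = m"
  then have s: "fill_state m s" "fst s ''i'' 0 = m" by auto
  let ?row = "NAssign ''row'' (NConst 0) (NPlus (NVar ''row'') (NVar ''n''))"
  let ?X = "fst s ''out'' ` {u. {u, m} \<in> E}"
  \<comment> \<open>The weakest precondition of the row update, which serves as the common
    postcondition of both branches.\<close>
  let ?Q = "\<lambda>s'. fill_state (Suc m) (exec ?row s') \<and> fst (exec ?row s') ''i'' 0 = m"
  have nk: "fst s ''n'' 0 = n" "fst s ''k'' 0 = k"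
    using s(1) agreeD[of "{''i'', ''j'', ''out'', ''cur'', ''p'', ''blk'', ''best'', ''row''}" "fst s" F]
    by (simp_all add: fill_state_def)
  let ?B = "\<lambda>s'. agree {''j'', ''blk'', ''best''} (fst s') (fst s) \<and> snd s' = snd s \<and> fst s' ''best'' 0 = 0 \<and>
       (\<forall>c. fst s' ''blk'' c \<le> Suc m) \<and> (\<forall>c. fst s' ''blk'' c = Suc m \<longleftrightarrow> c \<in> ?X)"
  let ?L = "\<lambda>s'. agree {''j'', ''blk'', ''best''} (fst s') (fst s) \<and> snd s' = snd s \<and>
       (\<forall>c. fst s' ''blk'' c \<le> Suc m) \<and> lightest (fst s' ''best'' 0) (snd s ''W'') ?X k"
  have light: "terminates (\<lambda>s'. s' = s \<and> fst s ''out'' m = 0)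
      (Seq (For ''j'' (NVar ''n'') block_body) (Seq (NAssign ''best'' (NConst 0) (NConst 0))
       (Seq (For ''j'' (NVar ''k'') select_body) place))) (n * 5 + 2 + (1 + (k * 5 + 2 + 2))) ?Q"
    if "fst s ''out'' m = 0"
  proof (intro terminates_Seq)
    show "terminates (\<lambda>s'. s' = s \<and> fst s ''out'' m = 0) (For ''j'' (NVar ''n'') block_body) (n * 5 + 2)
      (\<lambda>s'. agree {''j'', ''blk''} (fst s') (fst s) \<and> snd s' = snd s \<and>
       (\<forall>c. fst s' ''blk'' c \<le> Suc m) \<and> (\<forall>c. fst s' ''blk'' c = Suc m \<longleftrightarrow> c \<in> ?X))"
      by (rule terminates_weaken[OF block_loop[OF m s]]) auto
    show "terminates (\<lambda>s'. agree {''j'', ''blk''} (fst s') (fst s) \<and> snd s' = snd s \<and>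
       (\<forall>c. fst s' ''blk'' c \<le> Suc m) \<and> (\<forall>c. fst s' ''blk'' c = Suc m \<longleftrightarrow> c \<in> ?X))
       (NAssign ''best'' (NConst 0) (NConst 0)) 1 ?B"
      by (rule terminates_time[OF terminates_loop_free])
        (simp_all add: agree_mono[of "{''j'', ''blk''}" _ "fst s" "{''j'', ''blk'', ''best''}"] subset_insertI2)
    show "terminates ?B (For ''j'' (NVar ''k'') select_body) (k * 5 + 2) ?L"
    proof (rule terminates_fix)
      fix s' assume s': "?B s'"
      have "fst s' ''k'' 0 = k" "fst s' ''i'' 0 = m"
        using s' agreeD[of "{''j'', ''blk'', ''best''}" "fst s'" "fst s"] nk s(2) by simp_all
      then have "terminates (\<lambda>s''. s'' = s') (For ''j'' (NVar ''k'') select_body) (k * 5 + 2)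
        (\<lambda>s''. agree {''j'', ''best''} (fst s'') (fst s') \<and> snd s'' = snd s' \<and>
           lightest (fst s'' ''best'' 0) (snd s' ''W'') ?X k)"
        using s' by (intro select_loop) auto
      moreover have "?L s''" if "agree {''j'', ''best''} (fst s'') (fst s') \<and> snd s'' = snd s' \<and>
           lightest (fst s'' ''best'' 0) (snd s' ''W'') ?X k" for s'' :: state
        using that s' agreeD[of "{''j'', ''best''}" "fst s''" "fst s'" "''blk''"]
        by (simp add: agree_def)
      ultimately show "terminates (\<lambda>s''. s'' = s') (For ''j'' (NVar ''k'') select_body) (k * 5 + 2) ?L"
        by (elim terminates_weaken) blast+
    qed
    have "terminates ?L place (cost place) ?Q"
    proof (rule terminates_loop_free)
      fix s' assume "?L s'"
      then show "?Q (exec place s')"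
        using place[OF m s that, of s' "exec (Seq place ?row) s'"] by simp
    qed (simp add: place_def)
    then show "terminates ?L place 2 ?Q" by (simp add: place_def numeral_2_eq_2)
  qed
  have fill: "terminates (\<lambda>s'. s' = s \<and> bval (NLess (NCell ''out'' (NVar ''i'')) (NConst 1)) s')
      (Seq (For ''j'' (NVar ''n'') block_body) (Seq (NAssign ''best'' (NConst 0) (NConst 0))
       (Seq (For ''j'' (NVar ''k'') select_body) place))) (n * 5 + k * 5 + 7) ?Q"
  proof (cases "fst s ''out'' m = 0")
    case True
    show ?thesis by (rule terminates_weaken[OF light[OF True]]) (use True in auto)
  next
    case False
    then show ?thesis using s(2) by (simp add: terminates_def)
  qed
  have "?Q s" if "fst s ''out'' m \<noteq> 0"
    using s that filling_skip nk by (auto simp: fill_state_def le_SucI add.commute)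
  then have "terminates (\<lambda>s'. s' = s \<and> \<not> bval (NLess (NCell ''out'' (NVar ''i'')) (NConst 1)) s')
      Skip (n * 5 + k * 5 + 7) ?Q"
    using s(2) by (intro terminates_time[OF terminates_loop_free]) auto
  from terminates_Cond[OF fill this]
  have "terminates (\<lambda>s'. s' = s) fill_body (n * 5 + k * 5 + 7 + 1 + cost ?row)
      (\<lambda>s. fill_state (Suc m) s \<and> fst s ''i'' 0 = m)"
    unfolding fill_body_def by (rule terminates_Seq) (rule terminates_loop_free, auto)
  then show "terminates (\<lambda>s'. s' = s) fill_body (5 * n + 5 * k + 9)
      (\<lambda>s. fill_state (Suc m) s \<and> fst s ''i'' 0 = m)"
    by (rule terminates_time) simp
qed

lemma fill_loop:
  "terminates (cut_state n) (For ''i'' (NVar ''n'') fill_body) (n * (5 * n + 5 * k + 9 + 2) + 2) (fill_state n)"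
proof -
  have "terminates (fill_state 0) (For ''i'' (NVar ''n'') fill_body) (n * (5 * n + 5 * k + 9 + 2) + 2) (fill_state n)"
    by (rule terminates_For) (simp_all add: fill_body fill_state_n, simp add: fill_state_def)
  then show ?thesis by (rule terminates_weaken) (auto simp: fill_state_init)
qed

end

section \<open>Final states and running time\<close>

lemma (in eq1_positive_instance) fill_state_correct:
  assumes "fill_state n s"
  shows "is_coloring {..<n} E k (output_coloring n s) \<and>
    is_EQ1 w (1 + 7 * \<epsilon>) k (output_coloring n s)"
proof -
  have fill: "filling n (fst s ''out'') (snd s ''W'')"
    using assms by (simp add: fill_state_def)
  have out: "fst s ''out'' v \<in> {1..k}" if "v < n" for v
    using fill that by (auto simp: filling_def Suc_le_eq)
  moreover have "fst s ''out'' u \<noteq> fst s ''out'' v" if "{u, v} \<in> E" for u v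
  proof -
    have "fst s ''out'' u \<noteq> 0" using out[OF edge_vertex[OF that]] by simp
    then show ?thesis using fill that unfolding filling_def by metis
  qed
  ultimately show ?thesis
    using balanced[OF fill] by (intro conjI is_coloring_output is_EQ1_I) (auto simp: weight_output)
qed

text \<open>All vertices weigh 0, so any two colors compare; \<open>\<kappa> \<le> k\<close> makes
  the given colors admissible, and the others stay empty.\<close>

lemma (in eq1_instance) weightless_correct:
  assumes "S = 0" "\<forall>v<n. fst s ''out'' v = col v"
  shows "is_coloring {..<n} E k (output_coloring n s) \<and>
    is_EQ1 w (1 + 7 * \<epsilon>) k (output_coloring n s)"
proof -
  have "wgt v = 0" if "v < n" for v
    using assms(1) that wgt_nonneg unfolding S_def by (subst (asm) sum_nonneg_eq_0_iff) auto
  then have "(\<Sum>v | v < n \<and> fst s ''out'' v = i. wgt v) = 0" for i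
    by (intro sum.neutral) auto
  then have "is_EQ1 w (1 + 7 * \<epsilon>) k (output_coloring n s)"
    by (intro is_EQ1_I) (simp add: weight_output)
  moreover have "fst s ''out'' v \<in> {1..k}" if "v < n" for v
    using assms(2) col_eq[OF that] kappa_le_k that by auto
  moreover have "fst s ''out'' u \<noteq> fst s ''out'' v" if "{u, v} \<in> E" for u v
    using assms(2) col_proper[OF that] edge_vertex[of u v] edge_vertex[of v u] that
    by (simp add: insert_commute)
  ultimately show ?thesis by (intro conjI is_coloring_output)
qed

lemma (in eq1_instance) eq1_program_correct:
  "\<exists>t s. runs eq1_program (input_state n E w \<kappa> C' \<epsilon> k) t s \<and> t \<le> 16 * n ^ 2 + 41 * n + 13 \<and>
     is_coloring {..<n} E k (output_coloring n s) \<and> is_EQ1 w (1 + 7 * \<epsilon>) k (output_coloring n s)"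
proof -
  let ?Q = "\<lambda>s. is_coloring {..<n} E k (output_coloring n s) \<and>
    is_EQ1 w (1 + 7 * \<epsilon>) k (output_coloring n s)"
  let ?b = "RLess (RConst 0) (RVar ''T'')"
  let ?c = "Seq threshold (Seq scale_weights (Seq class_weights
    (Seq (For ''i'' (NVar ''n'') cut_body) (For ''i'' (NVar ''n'') fill_body))))"
  \<comment> \<open>The sum of the loop bounds of the main branch with \<open>k\<close> and
    \<open>\<kappa>\<close> replaced by \<open>n\<close>.\<close>
  let ?t = "16 * n ^ 2 + 35 * n + 10"
  have b: "bval ?b s \<longleftrightarrow> 0 < S" if "weighed n s" for s
    using that by (simp add: weighed_def S_def)
  have "terminates (\<lambda>s. weighed n s \<and> bval ?b s) ?c ?t ?Q"
  \<comment> \<open>The outcome of the test depends on the instance alone, so each branch is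
    analyzed under its own sign of \<open>S\<close>; in the opposite case its precondition is
    unsatisfiable.\<close>
  proof (cases "0 < S")
    case True
    interpret eq1_positive_instance by unfold_locales (rule True)
    have thr: "terminates (weighed n) threshold (k * 3 + 2) (scaling 0)"
    proof (rule terminates_weaken[OF threshold])
      fix s assume s: "agree {''i''} (fst s) F \<and> agree {''T'', ''M''} (snd s) G \<and> snd s ''T'' 0 = Tv"
      then have "agree {''i'', ''j''} (fst s) F" "agree {''T'', ''M'', ''wt''} (snd s) G"
        by (auto intro: agree_mono)
      moreover have "snd s ''wt'' = (\<lambda>_. 0)"
        using s agreeD[of "{''T'', ''M''}" "snd s" G "''wt''"] by simp
      ultimately show "scaling 0 s" using s by (simp add: scaling_def)
    qed simp_all
    have "terminates (weighed n) ?c (k * 3 + 2 + (n * ((k + \<kappa>) * 3 + 4) + 2 + (n * 3 + 2 +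
        (n * 14 + 2 + (n * (5 * n + 5 * k + 9 + 2) + 2))))) (fill_state n)"
      by (intro terminates_Seq[OF thr] terminates_Seq[OF scale_weights] terminates_Seq[OF class_weights]
          terminates_Seq[OF cut_loop] fill_loop)
    moreover have "k * 3 + 2 + (n * ((k + \<kappa>) * 3 + 4) + 2 + (n * 3 + 2 +
        (n * 14 + 2 + (n * (5 * n + 5 * k + 9 + 2) + 2)))) \<le> ?t"
    proof -
      have "n * (k + \<kappa>) \<le> n * (2 * n)" "n * k \<le> n * n"
        using k_le_n kappa_le_k by (intro mult_left_mono; simp)+
      moreover have "n * ((k + \<kappa>) * 3 + 4) = 3 * (n * (k + \<kappa>)) + 4 * n"
        "n * (5 * n + 5 * k + 9 + 2) = 5 * (n * n) + 5 * (n * k) + 11 * n"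
        by (simp_all add: algebra_simps)
      ultimately show ?thesis unfolding power2_eq_square using k_le_n by linarith
    qed
    ultimately show ?thesis
      using fill_state_correct by (elim terminates_weaken) blast+
  qed (use b in \<open>auto simp: terminates_def\<close>)
  moreover have "terminates (\<lambda>s. weighed n s \<and> \<not> bval ?b s) copy_coloring ?t ?Q"
  proof (cases "0 < S")
    case False
    with S_nonneg have "S = 0" by simp
    then show ?thesis
      by (intro terminates_weaken[OF copy_coloring]) (use weightless_correct in auto)
  qed (use b in \<open>auto simp: terminates_def\<close>)
  ultimately have "terminates (weighed 0) eq1_program (n * 6 + 2 + (?t + 1)) ?Q"
    unfolding eq1_program_def by (intro terminates_Seq[OF total_weight_and_max] terminates_Cond)
  moreover have "weighed 0 (input_state n E w \<kappa> C' \<epsilon> k)"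
    by (simp add: weighed_def agree_refl maxw_0 flip: F_def G_def)
  ultimately show ?thesis unfolding terminates_def by fastforce
qed

section \<open>Relabelling the vertices by an initial segment of the naturals\<close>

lemma eq1_coloring_transfer:
  fixes V :: "'v set" and h :: "nat \<Rightarrow> 'v"
  assumes h: "bij_betw h {..<n} V" and hyp: "eq1_hypotheses V E w \<kappa> C' \<epsilon> k"
  defines "E' \<equiv> {e. e \<subseteq> {..<n} \<and> h ` e \<in> E}" and "C'' \<equiv> \<lambda>i. {v. v < n \<and> h v \<in> C' i}"
  shows "eq1_hypotheses {..<n} E' (w \<circ> h) \<kappa> C'' \<epsilon> k"
    and "is_coloring {..<n} E' k C \<Longrightarrow> is_EQ1 (w \<circ> h) \<alpha> k C \<Longrightarrow>
      is_coloring V E k (\<lambda>i. h ` C i) \<and> is_EQ1 w \<alpha> k (\<lambda>i. h ` C i)"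
proof -
  have inj: "inj_on h {..<n}" and V: "V = h ` {..<n}"
    using h by (auto simp: bij_betw_def)
  have E: "e \<subseteq> V" "card e = 2" if "e \<in> E" for e
    using hyp that by (auto simp: eq1_hypotheses_def simple_graph_def)
  have edge: "{u, v} \<in> E' \<longleftrightarrow> {h u, h v} \<in> E" if "u < n" "v < n" for u v
    using that by (simp add: E'_def)
  have weight: "weight (w \<circ> h) X = weight w (h ` X)" if "X \<subseteq> {..<n}" for X
    unfolding weight_def using inj_on_subset[OF inj that] by (simp add: sum.reindex)
  have col: "is_coloring V E \<kappa> C'" using hyp by (simp add: eq1_hypotheses_def)
  have deg: "degree E' v = degree E (h v)" if "v < n" for v
  proof -
    have "h ` {u. {u, v} \<in> E'} = {u. {u, h v} \<in> E}"
    proof (intro equalityI subsetI)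
      fix y assume y: "y \<in> {u. {u, h v} \<in> E}"
      \<comment> \<open>Edges lie inside \<open>V\<close>, so every neighbor has a preimage; the
        neighborhoods then correspond bijectively and degrees agree.\<close>
      then obtain u where "u < n" "y = h u" using E(1)[of "{y, h v}"] V by auto
      with y that edge show "y \<in> h ` {u. {u, v} \<in> E'}" by auto
    qed (auto simp: E'_def)
    moreover have "{u. {u, v} \<in> E'} \<subseteq> {..<n}" by (auto simp: E'_def)
    ultimately show ?thesis
      unfolding degree_def by (metis card_image inj inj_on_subset)
  qed
  have "max_degree {..<n} E' = max_degree V E"
    unfolding max_degree_def V image_image using deg by (intro arg_cong[where f = Sup] image_cong) auto
  moreover have "simple_graph {..<n} E'"
  proof -
    have "card e = 2" if "e \<in> E'" for e
      using that E(2)[of "h ` e"] card_image[OF inj_on_subset[OF inj, of e]] by (auto simp: E'_def)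
    then show ?thesis by (auto simp: simple_graph_def E'_def)
  qed
  moreover have "is_coloring {..<n} E' \<kappa> C''"
    unfolding is_coloring_def
  proof (intro conjI ballI)
    show "(\<Union>i\<in>{1..\<kappa>}. C'' i) = {..<n}"
      using col V by (auto simp: is_coloring_def C''_def)
    show "disjoint_family_on C'' {1..\<kappa>}"
      using col by (fastforce simp: is_coloring_def C''_def disjoint_family_on_def)
    show "independent_set E' (C'' i)" if "i \<in> {1..\<kappa>}" for i
      using col that edge by (auto simp: is_coloring_def C''_def independent_set_def)
  qed
  ultimately show "eq1_hypotheses {..<n} E' (w \<circ> h) \<kappa> C'' \<epsilon> k"
    using hyp weight[of "{..<n}"] V by (auto simp: eq1_hypotheses_def)
  assume C: "is_coloring {..<n} E' k C" and eq1: "is_EQ1 (w \<circ> h) \<alpha> k C"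
  have sub: "C i \<subseteq> {..<n}" if "i \<in> {1..k}" for i
    using C that by (auto simp: is_coloring_def)
  have "is_coloring V E k (\<lambda>i. h ` C i)"
    unfolding is_coloring_def
  proof (intro conjI ballI)
    show "(\<Union>i\<in>{1..k}. h ` C i) = V"
      using C V by (auto simp: is_coloring_def simp flip: image_UN)
    show "disjoint_family_on (\<lambda>i. h ` C i) {1..k}"
      unfolding disjoint_family_on_def
    proof (intro ballI impI)
      fix i j assume ij: "i \<in> {1..k}" "j \<in> {1..k}" "i \<noteq> j"
      then have "C i \<inter> C j = {}" using C by (auto simp: is_coloring_def disjoint_family_on_def)
      then show "h ` C i \<inter> h ` C j = {}"
        using inj_on_image_Int[OF inj sub[OF ij(1)] sub[OF ij(2)]] by simp
    qed
    show "independent_set E (h ` C i)" if i: "i \<in> {1..k}" for i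
      unfolding independent_set_def
    proof (intro ballI)
      fix x y assume "x \<in> h ` C i" "y \<in> h ` C i"
      then obtain u v where uv: "u \<in> C i" "v \<in> C i" "x = h u" "y = h v" by blast
      then have "{u, v} \<notin> E'" using C i by (auto simp: is_coloring_def independent_set_def)
      then show "{x, y} \<notin> E" using edge[of u v] uv sub[OF i] by auto
    qed
  qed
  moreover have "is_EQ1 w \<alpha> k (\<lambda>i. h ` C i)"
    unfolding is_EQ1_def
  proof (intro ballI impI)
    fix i j assume ij: "i \<in> {1..k}" "j \<in> {1..k}" and "h ` C i \<noteq> {}"
    then obtain v where v: "v \<in> C i"
      "real_of_rat (weight (w \<circ> h) (C i - {v})) \<le> \<alpha> * real_of_rat (weight (w \<circ> h) (C j))"
      using eq1 unfolding is_EQ1_def by (metis image_empty)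
    moreover have "h ` (C i - {v}) = h ` C i - {h v}"
      using inj_on_image_set_diff[OF inj, of "C i" "{v}"] sub[OF ij(1)] v(1) by auto
    ultimately show "\<exists>v\<in>h ` C i. real_of_rat (weight w (h ` C i - {v})) \<le> \<alpha> * real_of_rat (weight w (h ` C j))"
      using weight[of "C i - {v}", OF order_trans[OF Diff_subset sub[OF ij(1)]]] weight[OF sub[OF ij(2)]]
      by (intro bexI[of _ "h v"]) auto
  qed
  ultimately show "is_coloring V E k (\<lambda>i. h ` C i) \<and> is_EQ1 w \<alpha> k (\<lambda>i. h ` C i)" ..
qed

theorem theorem10:
  "(\<forall>(V :: 'v set) E w \<kappa> C' \<epsilon> k. eq1_hypotheses V E w \<kappa> C' \<epsilon> k \<longrightarrow>
      (\<exists>C. is_coloring V E k C \<and> is_EQ1 w (1 + 7 * \<epsilon>) k C)) \<and>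
   (\<exists>(prog :: com) (d :: nat) (a :: nat \<Rightarrow> nat \<Rightarrow> nat).
      \<forall>n E w \<kappa> C' \<epsilon> k. eq1_hypotheses {..<n} E w \<kappa> C' \<epsilon> k \<longrightarrow>
        (\<exists>t s. runs prog (input_state n E w \<kappa> C' \<epsilon> k) t s \<and>
           real t \<le> (\<Sum>i\<le>d. \<Sum>j\<le>d. real (a i j) * real n ^ i * (1 / \<epsilon>) ^ j) \<and>
           is_coloring {..<n} E k (output_coloring n s) \<and>
           is_EQ1 w (1 + 7 * \<epsilon>) k (output_coloring n s)))"
proof (rule conjI)
  show "\<forall>(V :: 'v set) E w \<kappa> C' \<epsilon> k. eq1_hypotheses V E w \<kappa> C' \<epsilon> k \<longrightarrow>
      (\<exists>C. is_coloring V E k C \<and> is_EQ1 w (1 + 7 * \<epsilon>) k C)"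
  proof (intro allI impI)
    fix V :: "'v set" and E w \<kappa> C' \<epsilon> k
    assume inst: "eq1_hypotheses V E w \<kappa> C' \<epsilon> k"
    then have "finite V" by (simp add: eq1_hypotheses_def simple_graph_def)
    then obtain h where h: "bij_betw h {..<card V} V"
      using ex_bij_betw_nat_finite[of V] by (auto simp: atLeast0LessThan)
    \<comment> \<open>Existence for arbitrary vertices is read off from a run of the program on a
      numbered copy of the graph.\<close>
    interpret eq1_instance "card V" "{e. e \<subseteq> {..<card V} \<and> h ` e \<in> E}" "w \<circ> h" \<kappa>
      "\<lambda>i. {v. v < card V \<and> h v \<in> C' i}" \<epsilon> k
      using eq1_coloring_transfer(1)[OF h inst] by unfold_locales
    show "\<exists>C. is_coloring V E k C \<and> is_EQ1 w (1 + 7 * \<epsilon>) k C"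
      using eq1_program_correct eq1_coloring_transfer(2)[OF h inst] by blast
  qed
  \<comment> \<open>The coefficients of the time bound in powers of \<open>n\<close>; those of
    positive powers of 1/\<epsilon> are 0, since the bound depends on \<open>n\<close>
    alone.\<close>
  let ?a = "\<lambda>i j :: nat. if j = 0 then [13, 41, 16] ! i else 0 :: nat"
  have "\<exists>t s. runs eq1_program (input_state n E w \<kappa> C' \<epsilon> k) t s \<and>
           real t \<le> (\<Sum>i\<le>2. \<Sum>j\<le>2. real (?a i j) * real n ^ i * (1 / \<epsilon>) ^ j) \<and>
           is_coloring {..<n} E k (output_coloring n s) \<and>
           is_EQ1 w (1 + 7 * \<epsilon>) k (output_coloring n s)"
    if "eq1_hypotheses {..<n} E w \<kappa> C' \<epsilon> k" for n E w \<kappa> C' \<epsilon> k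
  proof -
    interpret eq1_instance n E w \<kappa> C' \<epsilon> k using that by unfold_locales
    obtain t s where ts: "runs eq1_program (input_state n E w \<kappa> C' \<epsilon> k) t s" "t \<le> 16 * n ^ 2 + 41 * n + 13"
      "is_coloring {..<n} E k (output_coloring n s)" "is_EQ1 w (1 + 7 * \<epsilon>) k (output_coloring n s)"
      using eq1_program_correct by blast
    have "(\<Sum>i\<le>2. \<Sum>j\<le>2. real (?a i j) * real n ^ i * (1 / \<epsilon>) ^ j) = real (16 * n ^ 2 + 41 * n + 13)"
      by (simp add: numeral_2_eq_2)
    with ts(2) have "real t \<le> (\<Sum>i\<le>2. \<Sum>j\<le>2. real (?a i j) * real n ^ i * (1 / \<epsilon>) ^ j)"
      by (simp only: of_nat_le_iff)
    with ts show ?thesis by blast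
  qed
  note correct = this
  show "\<exists>(prog :: com) (d :: nat) (a :: nat \<Rightarrow> nat \<Rightarrow> nat).
      \<forall>n E w \<kappa> C' \<epsilon> k. eq1_hypotheses {..<n} E w \<kappa> C' \<epsilon> k \<longrightarrow>
        (\<exists>t s. runs prog (input_state n E w \<kappa> C' \<epsilon> k) t s \<and>
           real t \<le> (\<Sum>i\<le>d. \<Sum>j\<le>d. real (a i j) * real n ^ i * (1 / \<epsilon>) ^ j) \<and>
           is_coloring {..<n} E k (output_coloring n s) \<and>
           is_EQ1 w (1 + 7 * \<epsilon>) k (output_coloring n s))"
    by (rule exI[of _ eq1_program], rule exI[of _ 2], rule exI[of _ ?a], intro allI impI, rule correct)
qed

end
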